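(* Let $X$ be a countable set and let $F(X)$ be the free abelian semigroup generated by $X$. Then, for $\lambda=\pm1$, the algebra $\mathrm{MS}_{\mathbb{Z},\lambda}(F(X))$ is a polynomial $\mathbb{Z}$-algebra.
   Context: Mixable shuffle algebra: for a commutative ring $\mathbf{k}$, $\lambda\in\mathbf{k}$ and an abelian semigroup $S$, $\mathrm{MS}_{\mathbf{k},\lambda}(S)$ is the free $\mathbf{k}$-module on the words $M^{\otimes}(S)=\{1\}\cup\{u_1\otimes\cdots\otimes u_r\mid u_i\in S,\ r\ge1\}$ with the bilinear product $\diamond$ with identity $1$ and $(a\otimes\mathfrak{a}')\diamond(b\otimes\mathfrak{b}')=a\otimes(\mathfrak{a}'\diamond(b\otimes\mathfrak{b}'))+b\otimes((a\otimes\mathfrak{a}')\diamond\mathfrak{b}')+\lambda\,(ab)\otimes(\mathfrak{a}'\diamond\mathfrak{b}')$ for letters $a,b\in S$ and (possibly empty) words $\mathfrak{a}',\mathfrak{b}'$ (with $a\otimes1$ read as $a$). Free abelian semigroups have no identity element. *)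

theory Defs
  imports
    "HOL-Algebra.Module"
    "HOL-Algebra.QuotRing"
    "HOL-Library.Multiset"
    "HOL-Library.Countable_Set"
    "HOL-Library.Poly_Mapping"
begin

section \<open>The free abelian semigroup\<close>

text \<open>
  An element of the free abelian semigroup on \<open>X\<close> is a nonempty commutative monomial in letters
  from \<open>X\<close>, i.e. a nonempty multiset over \<open>X\<close>; the semigroup law is multiset union \<open>+\<close>.
  The empty multiset is excluded, so there is no identity element.
\<close>

definition free_abelian_semigroup :: "'x set \<Rightarrow> 'x multiset set" where
  "free_abelian_semigroup X = {M. M \<noteq> {#} \<and> set_mset M \<subseteq> X}"

section \<open>The mixable shuffle algebra\<close>

text \<open>
  The law of the semigroup of letters is written additively (it comes from the class
  \<^class>\<open>ab_semigroup_add\<close>), so the letter \<open>ab\<close> of the informal recursion is \<open>a + b\<close> here.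
  The word \<open>u\<^sub>1 \<otimes> \<dots> \<otimes> u\<^sub>r\<close> is the list \<open>[u\<^sub>1, \<dots>, u\<^sub>r]\<close>, the identity \<open>1\<close> is the empty word,
  and a \<open>k\<close>-linear combination of words is a finitely supported function from words to \<open>k\<close>.
\<close>

definition prepend_letter :: "'s \<Rightarrow> ('s list \<Rightarrow>\<^sub>0 'k::comm_ring_1) \<Rightarrow> ('s list \<Rightarrow>\<^sub>0 'k)" where
  "prepend_letter a p =
     (\<Sum>w\<in>Poly_Mapping.keys p. Poly_Mapping.single (a # w) (Poly_Mapping.lookup p w))"

definition scale :: "'k::comm_ring_1 \<Rightarrow> ('w \<Rightarrow>\<^sub>0 'k) \<Rightarrow> ('w \<Rightarrow>\<^sub>0 'k)" where
  "scale c p = Poly_Mapping.map ((*) c) p"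

fun word_mixable_shuffle ::
  "'k::comm_ring_1 \<Rightarrow> 's::ab_semigroup_add list \<Rightarrow> 's list \<Rightarrow> ('s list \<Rightarrow>\<^sub>0 'k)" where
  "word_mixable_shuffle lam [] v = Poly_Mapping.single v 1"
| "word_mixable_shuffle lam (a # u) [] = Poly_Mapping.single (a # u) 1"
| "word_mixable_shuffle lam (a # u) (b # v) =
     prepend_letter a (word_mixable_shuffle lam u (b # v))
     + prepend_letter b (word_mixable_shuffle lam (a # u) v)
     + scale lam (prepend_letter (a + b) (word_mixable_shuffle lam u v))"

definition mixable_shuffle ::
  "'k::comm_ring_1 \<Rightarrow> ('s::ab_semigroup_add list \<Rightarrow>\<^sub>0 'k) \<Rightarrow> ('s list \<Rightarrow>\<^sub>0 'k) \<Rightarrow> ('s list \<Rightarrow>\<^sub>0 'k)"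
where
  "mixable_shuffle lam p q =
     (\<Sum>u\<in>Poly_Mapping.keys p. \<Sum>v\<in>Poly_Mapping.keys q.
        scale (Poly_Mapping.lookup p u * Poly_Mapping.lookup q v) (word_mixable_shuffle lam u v))"

text \<open>
  \<open>S\<close> is meant to be a subsemigroup of its type, i.e. closed under \<open>+\<close>. The base ring is the
  whole type \<open>'k\<close>.
\<close>

definition mixable_shuffle_algebra ::
  "'k::comm_ring_1 \<Rightarrow> 's::ab_semigroup_add set \<Rightarrow> ('k, 's list \<Rightarrow>\<^sub>0 'k) module" where
  "mixable_shuffle_algebra lam S =
     \<lparr>carrier = {p. Poly_Mapping.keys p \<subseteq> lists S},
      monoid.mult = mixable_shuffle lam,
      one = Poly_Mapping.single [] 1,
      ring.zero = 0,
      add = (+),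
      smult = scale\<rparr>"

section \<open>Polynomial algebras\<close>

text \<open>
  Polynomials over \<open>'k\<close> in the variables \<open>Y\<close> (a possibly infinite set): finitely supported
  functions on monomials \<open>'y \<Rightarrow>\<^sub>0 nat\<close>, multiplied by convolution.
\<close>

definition polynomial_algebra :: "'y set \<Rightarrow> ('k::comm_ring_1, ('y \<Rightarrow>\<^sub>0 nat) \<Rightarrow>\<^sub>0 'k) module" where
  "polynomial_algebra Y =
     \<lparr>carrier = {p. \<forall>m\<in>Poly_Mapping.keys p. Poly_Mapping.keys m \<subseteq> Y},
      monoid.mult = (*),
      one = 1,
      ring.zero = 0,
      add = (+),
      smult = scale\<rparr>"

text \<open>
  A \<open>k\<close>-algebra is a polynomial algebra if it is isomorphic, as a \<open>k\<close>-algebra, to the algebra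
  of polynomials in some set \<open>Y\<close> of variables. Taking \<open>Y\<close> inside the element type of \<open>A\<close> loses
  nothing: as \<open>k\<close> is nontrivial, an isomorphism is injective on the variables, which can then be
  renamed to their images in \<open>A\<close>.
\<close>

definition is_polynomial_algebra :: "('k::comm_ring_1, 'a) module \<Rightarrow> bool" where
  "is_polynomial_algebra A \<longleftrightarrow>
     (\<exists>(Y :: 'a set) h.
        h \<in> ring_iso (polynomial_algebra Y :: ('k, ('a \<Rightarrow>\<^sub>0 nat) \<Rightarrow>\<^sub>0 'k) module) A \<and>
        (\<forall>(c :: 'k). \<forall>p\<in>carrier (polynomial_algebra Y).
           h (c \<odot>\<^bsub>polynomial_algebra Y\<^esub> p) = c \<odot>\<^bsub>A\<^esub> h p))"

end

theory Submission
  imports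
    Defs
    "HOL-Library.List_Lexorder"
    "HOL-Library.Multiset_Order"
    "HOL-Library.Function_Algebras"
    "HOL-Computational_Algebra.Formal_Power_Series"
    "Jordan_Normal_Form.Determinant"
begin

text \<open>
  The proof follows the idea behind the theorem of Hazewinkel that quasi-symmetric functions form a
  polynomial ring over the integers (the case of a one-element \<open>X\<close>).

  A word \<open>[u\<^sub>1, \<dots>, u\<^sub>r]\<close> is read as the quasi-symmetric function \<open>\<Sum> x\<^sub>i\<^sub>1^u\<^sub>1 * \<dots> * x\<^sub>i\<^sub>r^u\<^sub>r\<close> with strictly monotone
  indices. In this reading the mixable shuffle product of weight one is ordinary multiplication
  (\<open>qsym_word_mixable_shuffle\<close>), and weight \<open>-1\<close> only changes the sign of words of odd length. So the
  algebra is a subring of a commutative ring, where elementary symmetric functions \<open>e\<^sub>n(w)\<close> of the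
  monomials of a word \<open>w\<close> make sense. They belong to the algebra again (\<open>realise_elem_sym\<close>).

  Order the letters linearly and compatibly with scaling. A Lyndon word is then \<open>n\<close> times a primitive
  Lyndon word \<open>u\<close>, in the sense that all its letters are \<open>n\<close>-th powers, with \<open>n\<close> maximal. Its generator is
  \<open>e\<^sub>n(u)\<close>. These elements generate the algebra for two reasons. First, all words are generated by the
  \<open>e\<^sub>n(v)\<close> with \<open>v\<close> an arbitrary Lyndon word: the leading word of \<open>e\<^sub>n(v)\<close> is \<open>v\<close> repeated \<open>n\<close> times, and
  products in decreasing order lead with the concatenation, always with coefficient one
  (\<open>leading_elem_sym\<close>, \<open>leading_mixable_shuffle\<close>); now every word is a decreasing product of Lyndon words.
  Second, for \<open>v\<close> equal to \<open>n\<close> times \<open>u\<close>, the element \<open>e\<^sub>r(v)\<close> is an elementary symmetric function of \<open>n\<close>-th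
  powers, hence an integer polynomial in the \<open>e\<^sub>k(u)\<close>; a norm computation shows this
  (\<open>esym_power_in_ring_closure\<close>).

  Independence comes from counting. The content of a word, the sum of its letters, is a grading with
  finite components. The generator of a Lyndon word has the content of that word, and by unique
  factorization the monomials in the generators with a given content are as many as the words with
  that content. A spanning family of the right size in a finitely generated free abelian group is a
  basis (\<open>generator_prods_independent\<close>).

  Countability of \<open>X\<close> is used to rename its elements to natural numbers, which provides the linear
  order.
\<close>

section \<open>Linear structure of the mixable shuffle product\<close>

lemma lookup_scale [simp]: "Poly_Mapping.lookup (scale c p) w = c * Poly_Mapping.lookup p w"
  by (simp add: scale_def Poly_Mapping.map.rep_eq when_def)

lemma keys_scale: "Poly_Mapping.keys (scale c p) \<subseteq> Poly_Mapping.keys p"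
  by (auto simp: in_keys_iff)

lemma scale_one [simp]: "scale 1 p = p"
  by (rule poly_mapping_eqI) simp

lemma lookup_prepend_letter:
  "Poly_Mapping.lookup (prepend_letter a p) w =
     (case w of [] \<Rightarrow> 0 | b # v \<Rightarrow> if b = a then Poly_Mapping.lookup p v else 0)"
proof (cases w)
  case Nil
  then show ?thesis by (simp add: prepend_letter_def lookup_sum lookup_single)
next
  case (Cons b v)
  have "(\<Sum>x\<in>Poly_Mapping.keys p. (Poly_Mapping.lookup p x when a # x = w)) =
      (\<Sum>x\<in>Poly_Mapping.keys p. if x = v then (if b = a then Poly_Mapping.lookup p v else 0) else 0)"
    by (rule sum.cong) (auto simp: Cons when_def)
  then show ?thesis
    by (auto simp: prepend_letter_def lookup_sum lookup_single Cons in_keys_iff)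
qed

lemma keys_prepend_letter [simp]: "Poly_Mapping.keys (prepend_letter a p) = (#) a ` Poly_Mapping.keys p"
  by (auto simp: in_keys_iff lookup_prepend_letter image_iff split: list.splits if_splits)

lemma word_mixable_shuffle_Nil2 [simp]: "word_mixable_shuffle lam u [] = Poly_Mapping.single u 1"
  by (cases u) auto

lemma lookup_mixable_shuffle:
  "Poly_Mapping.lookup (mixable_shuffle lam p q) w =
    (\<Sum>u\<in>Poly_Mapping.keys p. \<Sum>v\<in>Poly_Mapping.keys q.
      Poly_Mapping.lookup p u * Poly_Mapping.lookup q v * Poly_Mapping.lookup (word_mixable_shuffle lam u v) w)"
  by (simp add: mixable_shuffle_def lookup_sum)

lemma keys_mixable_shuffle:
  "Poly_Mapping.keys (mixable_shuffle lam p q) \<subseteq>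
    (\<Union>u\<in>Poly_Mapping.keys p. \<Union>v\<in>Poly_Mapping.keys q. Poly_Mapping.keys (word_mixable_shuffle lam u v))"
proof
  fix w assume "w \<in> Poly_Mapping.keys (mixable_shuffle lam p q)"
  then have "Poly_Mapping.lookup (mixable_shuffle lam p q) w \<noteq> 0" by (simp add: in_keys_iff)
  then obtain u v where "u \<in> Poly_Mapping.keys p" "v \<in> Poly_Mapping.keys q"
    "Poly_Mapping.lookup (word_mixable_shuffle lam u v) w \<noteq> 0"
    unfolding lookup_mixable_shuffle
    by (metis (no_types, lifting) mult_zero_right sum.neutral)
  then show "w \<in> (\<Union>u\<in>Poly_Mapping.keys p. \<Union>v\<in>Poly_Mapping.keys q. Poly_Mapping.keys (word_mixable_shuffle lam u v))"
    unfolding UN_iff by (meson in_keys_iff)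
qed

lemma keys_word_mixable_shuffle_Cons:
  assumes "w \<in> Poly_Mapping.keys (word_mixable_shuffle lam (a # u) (b # v))"
  shows "(\<exists>x. w = a # x \<and> x \<in> Poly_Mapping.keys (word_mixable_shuffle lam u (b # v))) \<or>
    (\<exists>x. w = b # x \<and> x \<in> Poly_Mapping.keys (word_mixable_shuffle lam (a # u) v)) \<or>
    (\<exists>x. w = (a + b) # x \<and> x \<in> Poly_Mapping.keys (word_mixable_shuffle lam u v))"
  using assms keys_scale[of lam "prepend_letter (a + b) (word_mixable_shuffle lam u v)"]
  by (auto dest!: subsetD[OF Poly_Mapping.keys_add])

text \<open>
  With \<open>S\<close> a subsemigroup, the words over \<open>S\<close> span a subalgebra.
\<close>

lemma keys_word_mixable_shuffle_lists:
  assumes "\<And>a b. a \<in> S \<Longrightarrow> b \<in> S \<Longrightarrow> a + b \<in> S"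
  shows "u \<in> lists S \<Longrightarrow> v \<in> lists S \<Longrightarrow> Poly_Mapping.keys (word_mixable_shuffle lam u v) \<subseteq> lists S"
proof (induction lam u v rule: word_mixable_shuffle.induct)
  case (3 lam a u b v)
  then have ab: "a \<in> S" "b \<in> S" "a + b \<in> S"
    and sub: "Poly_Mapping.keys (word_mixable_shuffle lam u (b # v)) \<subseteq> lists S"
      "Poly_Mapping.keys (word_mixable_shuffle lam (a # u) v) \<subseteq> lists S"
      "Poly_Mapping.keys (word_mixable_shuffle lam u v) \<subseteq> lists S"
    using assms by auto
  show ?case
  proof
    fix w assume "w \<in> Poly_Mapping.keys (word_mixable_shuffle lam (a # u) (b # v))"
    from keys_word_mixable_shuffle_Cons[OF this] show "w \<in> lists S"
      using ab sub by (elim disjE exE conjE) (metis lists.Cons subsetD)+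
  qed
qed auto

text \<open>
  Each contraction \<open>a + b\<close> costs one letter, so only true shuffles have full length.
\<close>

lemma length_word_mixable_shuffle:
  "w \<in> Poly_Mapping.keys (word_mixable_shuffle lam u v) \<Longrightarrow> length w \<le> length u + length v"
proof (induction lam u v arbitrary: w rule: word_mixable_shuffle.induct)
  case (3 lam a u b v)
  then show ?case
    using keys_word_mixable_shuffle_Cons[OF 3(4)] by fastforce
qed auto

text \<open>
  The product is graded by the content, that is, the sum of all letters of a word.
\<close>

lemma sum_list_word_mixable_shuffle:
  fixes u v :: "'a::comm_monoid_add list"
  shows "w \<in> Poly_Mapping.keys (word_mixable_shuffle lam u v) \<Longrightarrow> sum_list w = sum_list u + sum_list v"
proof (induction lam u v arbitrary: w rule: word_mixable_shuffle.induct)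
  case (3 lam a u b v)
  then show ?case
    using keys_word_mixable_shuffle_Cons[OF 3(4)] by (auto simp: algebra_simps)
qed auto

section \<open>Linear extension\<close>

lemma poly_mapping_eq_sum_single:
  "p = (\<Sum>r\<in>Poly_Mapping.keys p. Poly_Mapping.single r (Poly_Mapping.lookup p r))"
  for p :: "'a \<Rightarrow>\<^sub>0 'b::comm_monoid_add"
  by (rule poly_mapping_eqI) (auto simp: lookup_sum lookup_single when_def in_keys_iff)

text \<open>
  The linear extension of a map on basis elements; with a multiplicative \<open>g\<close> it is also the evaluation
  of polynomials.
\<close>

definition lin_ext :: "('w \<Rightarrow> 'r::comm_ring_1) \<Rightarrow> ('w \<Rightarrow>\<^sub>0 int) \<Rightarrow> 'r" where
  "lin_ext g p = (\<Sum>w\<in>Poly_Mapping.keys p. of_int (Poly_Mapping.lookup p w) * g w)"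

lemma lin_ext_superset:
  assumes "finite F" "Poly_Mapping.keys p \<subseteq> F"
  shows "lin_ext g p = (\<Sum>w\<in>F. of_int (Poly_Mapping.lookup p w) * g w)"
  unfolding lin_ext_def by (rule sum.mono_neutral_left) (use assms in \<open>auto simp: in_keys_iff\<close>)

lemma lin_ext_zero [simp]: "lin_ext g 0 = 0"
  by (simp add: lin_ext_def)

lemma lin_ext_single [simp]: "lin_ext g (Poly_Mapping.single w c) = of_int c * g w"
  by (simp add: lin_ext_def)

lemma lin_ext_add: "lin_ext g (p + q) = lin_ext g p + lin_ext g q"
proof -
  let ?F = "Poly_Mapping.keys p \<union> Poly_Mapping.keys q"
  have "Poly_Mapping.keys (p + q) \<subseteq> ?F" by (rule Poly_Mapping.keys_add)
  then show ?thesis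
    by (simp add: lin_ext_superset[of ?F] lookup_add sum.distrib algebra_simps)
qed

lemma lin_ext_scale: "lin_ext g (scale c p) = of_int c * lin_ext g p"
  using keys_scale[of c p]
  by (simp add: lin_ext_superset[of "Poly_Mapping.keys p"] sum_distrib_left algebra_simps)

lemma lin_ext_uminus: "lin_ext g (- p) = - lin_ext g p"
  by (simp add: lin_ext_def sum_negf)

lemma lin_ext_diff: "lin_ext g (p - q) = lin_ext g p - lin_ext g q"
  using lin_ext_add[of g p "- q"] by (simp add: lin_ext_uminus)

lemma lin_ext_sum: "lin_ext g (\<Sum>i\<in>I. p i) = (\<Sum>i\<in>I. lin_ext g (p i))"
  by (induction I rule: infinite_finite_induct) (auto simp: lin_ext_add)

lemma lin_ext_cong: "(\<And>w. w \<in> Poly_Mapping.keys p \<Longrightarrow> g w = h w) \<Longrightarrow> lin_ext g p = lin_ext h p"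
  by (simp add: lin_ext_def)

lemma lin_ext_add_fun: "lin_ext (\<lambda>w. g w + h w) p = lin_ext g p + lin_ext h p"
  by (simp add: lin_ext_def algebra_simps sum.distrib)

lemma lin_ext_mult_fun: "lin_ext (\<lambda>w. c * g w) p = c * lin_ext g p"
  by (simp add: lin_ext_def sum_distrib_left mult_ac)

lemma lin_ext_prepend_letter: "lin_ext g (prepend_letter a p) = lin_ext (\<lambda>w. g (a # w)) p"
  by (simp add: lin_ext_def sum.reindex lookup_prepend_letter)

lemma lin_ext_mixable_shuffle:
  assumes "\<And>u v. u \<in> Poly_Mapping.keys p \<Longrightarrow> v \<in> Poly_Mapping.keys q \<Longrightarrow>
    lin_ext g (word_mixable_shuffle lam u v) = g u * g v"
  shows "lin_ext g (mixable_shuffle lam p q) = lin_ext g p * lin_ext g q"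
proof -
  have "lin_ext g (mixable_shuffle lam p q) =
    (\<Sum>u\<in>Poly_Mapping.keys p. \<Sum>v\<in>Poly_Mapping.keys q.
      (of_int (Poly_Mapping.lookup p u) * g u) * (of_int (Poly_Mapping.lookup q v) * g v))"
    unfolding mixable_shuffle_def lin_ext_sum lin_ext_scale
    using assms by (intro sum.cong refl) (simp add: algebra_simps)
  then show ?thesis by (simp add: lin_ext_def sum_product)
qed

lemma lin_ext_mult:
  fixes p q :: "'a::monoid_add \<Rightarrow>\<^sub>0 int"
  assumes g: "\<And>a b. g (a + b) = g a * g b"
  shows "lin_ext g (p * q) = lin_ext g p * lin_ext g q"
proof -
  have "p * q = (\<Sum>a\<in>Poly_Mapping.keys p. \<Sum>b\<in>Poly_Mapping.keys q.
    Poly_Mapping.single (a + b) (Poly_Mapping.lookup p a * Poly_Mapping.lookup q b))"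
    by (subst poly_mapping_eq_sum_single[of p], subst poly_mapping_eq_sum_single[of q]) (simp add: sum_product mult_single)
  then show ?thesis
    by (simp add: lin_ext_sum g lin_ext_def[of g p] lin_ext_def[of g q] sum_product mult_ac)
qed

lemma sum_fun_apply: "(\<Sum>i\<in>I. f i) x = (\<Sum>i\<in>I. f i x)"
  for f :: "'i \<Rightarrow> 'a \<Rightarrow> 'b::comm_monoid_add"
  by (induction I rule: infinite_finite_induct) auto

lemma of_int_fun_apply: "(of_int c :: 'a \<Rightarrow> 'b::comm_ring_1) x = of_int c"
proof -
  have "(of_nat n :: 'a \<Rightarrow> 'b) x = of_nat n" for n by (induction n) auto
  then show ?thesis by (cases c) auto
qed

lemma lin_ext_fun_apply: "lin_ext g p x = lin_ext (\<lambda>w. g w x) p"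
  for g :: "'w \<Rightarrow> 'a \<Rightarrow> 'r::comm_ring_1"
  by (simp add: lin_ext_def sum_fun_apply of_int_fun_apply)

section \<open>Words as quasi-symmetric functions\<close>

definition var :: "nat \<Rightarrow> 'c::comm_monoid_add \<Rightarrow> (nat \<Rightarrow>\<^sub>0 'c) \<Rightarrow>\<^sub>0 int" where
  "var i c = Poly_Mapping.single (Poly_Mapping.single i c) 1"

lemma var_add: "var i (a + b) = var i a * var i b"
  by (simp add: var_def mult_single single_add)

text \<open>
  In the variables with index below \<open>m\<close>, the word \<open>[u\<^sub>1, \<dots>, u\<^sub>r]\<close> becomes the quasi-symmetric function
  \<open>\<Sum> var i\<^sub>1 u\<^sub>1 * \<dots> * var i\<^sub>r u\<^sub>r\<close> over \<open>m > i\<^sub>1 > \<dots> > i\<^sub>r\<close>. The indices decrease so that the newest variable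
  meets the first letter, which makes the recursion match that of the mixable shuffle.
\<close>

fun trunc_qsym :: "nat \<Rightarrow> 'c::comm_monoid_add list \<Rightarrow> (nat \<Rightarrow>\<^sub>0 'c) \<Rightarrow>\<^sub>0 int" where
  "trunc_qsym m [] = 1"
| "trunc_qsym 0 (a # w) = 0"
| "trunc_qsym (Suc m) (a # w) = trunc_qsym m (a # w) + var m a * trunc_qsym m w"

text \<open>
  The power of \<open>lam\<close> turns the product for weight \<open>lam\<close> into that for weight one. The map \<open>f\<close> allows the
  letters to be renamed. The result is a function of the number \<open>m\<close> of variables, an element of a
  product of rings.
\<close>

definition qsym :: "int \<Rightarrow> ('s \<Rightarrow> 'c::comm_monoid_add) \<Rightarrow> 's list \<Rightarrow> nat \<Rightarrow> (nat \<Rightarrow>\<^sub>0 'c) \<Rightarrow>\<^sub>0 int" where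
  "qsym lam f w m = of_int (lam ^ length w) * trunc_qsym m (map f w)"

lemma qsym_Nil [simp]: "qsym lam f [] m = 1"
  by (simp add: qsym_def)

lemma qsym_0 [simp]: "qsym lam f (a # w) 0 = 0"
  by (simp add: qsym_def)

lemma qsym_Suc: "qsym lam f (a # w) (Suc m) =
  qsym lam f (a # w) m + of_int lam * var m (f a) * qsym lam f w m"
  by (simp add: qsym_def algebra_simps)

lemma lin_ext_qsym_Suc_prepend_letter:
  "lin_ext (\<lambda>w. qsym lam f w (Suc m)) (prepend_letter a p) =
    lin_ext (\<lambda>w. qsym lam f w m) (prepend_letter a p) + of_int lam * var m (f a) * lin_ext (\<lambda>w. qsym lam f w m) p"
  by (simp add: lin_ext_prepend_letter qsym_Suc lin_ext_add_fun lin_ext_mult_fun)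

text \<open>
  With the new variable \<open>x\<close>, the factors have the form \<open>A + lam * x\<^sup>a * A'\<close> and \<open>B + lam * x\<^sup>b * B'\<close>. The
  three products that contain \<open>x\<close> are the three terms of the recursion for the mixable shuffle.
\<close>

lemma qsym_word_mixable_shuffle:
  fixes f :: "'s::ab_semigroup_add \<Rightarrow> 'c::comm_monoid_add"
  assumes f: "\<And>a b. f (a + b) = f a + f b"
  shows "lin_ext (\<lambda>w. qsym lam f w m) (word_mixable_shuffle lam u v) = qsym lam f u m * qsym lam f v m"
proof (induction m arbitrary: u v)
  case 0
  show ?case
    by (cases u; cases v) (simp_all add: lin_ext_add lin_ext_scale lin_ext_prepend_letter, simp_all add: lin_ext_def)
next
  case (Suc m)
  show ?case
  proof (cases "u = [] \<or> v = []")
    case True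
    then show ?thesis by auto
  next
    case False
    then obtain a u' b v' where uv: "u = a # u'" "v = b # v'" by (meson neq_Nil_conv)
    have "lin_ext (\<lambda>w. qsym lam f w (Suc m)) (word_mixable_shuffle lam u v) =
      lin_ext (\<lambda>w. qsym lam f w m) (word_mixable_shuffle lam u v)
      + of_int lam * var m (f a) * (qsym lam f u' m * qsym lam f v m)
      + of_int lam * var m (f b) * (qsym lam f u m * qsym lam f v' m)
      + of_int lam * (of_int lam * var m (f (a + b)) * (qsym lam f u' m * qsym lam f v' m))"
      by (simp add: uv lin_ext_add lin_ext_scale lin_ext_qsym_Suc_prepend_letter Suc.IH algebra_simps)
    also have "\<dots> = qsym lam f u (Suc m) * qsym lam f v (Suc m)"
      by (simp only: Suc.IH) (simp add: uv qsym_Suc f var_add algebra_simps)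
    finally show ?thesis .
  qed
qed

definition realise :: "int \<Rightarrow> ('s \<Rightarrow> 'c::comm_monoid_add) \<Rightarrow> ('s list \<Rightarrow>\<^sub>0 int) \<Rightarrow> nat \<Rightarrow> (nat \<Rightarrow>\<^sub>0 'c) \<Rightarrow>\<^sub>0 int" where
  "realise lam f = lin_ext (qsym lam f)"

lemma realise_mixable_shuffle:
  fixes f :: "'s::ab_semigroup_add \<Rightarrow> 'c::comm_monoid_add"
  assumes f: "\<And>a b. f (a + b) = f a + f b"
  shows "realise lam f (mixable_shuffle lam p q) = realise lam f p * realise lam f q"
  unfolding realise_def
  by (rule lin_ext_mixable_shuffle)
     (auto simp: fun_eq_iff lin_ext_fun_apply qsym_word_mixable_shuffle[OF f])

lemma realise_one [simp]: "realise lam f (Poly_Mapping.single [] 1) = 1"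
  by (auto simp: realise_def fun_eq_iff)

lemma realise_single: "realise lam f (Poly_Mapping.single w 1) = qsym lam f w"
  by (simp add: realise_def)

text \<open>
  The monomial of \<open>w\<close> that uses all of the first \<open>length w\<close> variables. If the letters of \<open>w\<close> are
  nonzero, no other word contributes to it, which gives coefficient extraction and injectivity of the
  realisation.
\<close>

fun full_monomial :: "'c::comm_monoid_add list \<Rightarrow> nat \<Rightarrow>\<^sub>0 'c" where
  "full_monomial [] = 0"
| "full_monomial (a # w) = Poly_Mapping.single (length w) a + full_monomial w"

lemma lookup_full_monomial: "length w \<le> n \<Longrightarrow> Poly_Mapping.lookup (full_monomial w) n = 0"
  by (induction w) (auto simp: lookup_add lookup_single)

lemma lookup_single_mult:
  "Poly_Mapping.lookup (Poly_Mapping.single s 1 * p) t = 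
    (\<Sum>r\<in>Poly_Mapping.keys p. if s + r = t then Poly_Mapping.lookup p r else 0)"
  for p :: "'a::monoid_add \<Rightarrow>\<^sub>0 'b::comm_ring_1"
proof -
  have "Poly_Mapping.single s 1 * p =
    (\<Sum>r\<in>Poly_Mapping.keys p. Poly_Mapping.single s 1 * Poly_Mapping.single r (Poly_Mapping.lookup p r))"
    by (subst (1) poly_mapping_eq_sum_single) (rule sum_distrib_left)
  then show ?thesis
    by (simp add: mult_single lookup_sum lookup_single when_def)
qed

lemma keys_trunc_qsym:
  "x \<in> Poly_Mapping.keys (trunc_qsym m w) \<Longrightarrow> m \<le> n \<Longrightarrow> Poly_Mapping.lookup x n = 0"
proof (induction m w arbitrary: x rule: trunc_qsym.induct)
  case (3 m a w)
  from 3(3) consider "x \<in> Poly_Mapping.keys (trunc_qsym m (a # w))" |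
    "x \<in> Poly_Mapping.keys (var m a * trunc_qsym m w)"
    by (auto dest!: subsetD[OF Poly_Mapping.keys_add])
  then show ?case
  proof cases
    case 1
    then show ?thesis using 3 by simp
  next
    case 2
    then obtain y where "x = Poly_Mapping.single m a + y" "y \<in> Poly_Mapping.keys (trunc_qsym m w)"
      by (auto simp: var_def dest!: subsetD[OF keys_mult])
    then show ?thesis using 3 by (simp add: lookup_add lookup_single)
  qed
qed auto

lemma lookup_trunc_qsym_full_monomial:
  fixes w :: "'c::cancel_comm_monoid_add list"
  assumes "0 \<notin> set w"
  shows "Poly_Mapping.lookup (trunc_qsym (length w) u) (full_monomial w) = (if u = w then 1 else 0)"
  using assms
proof (induction w arbitrary: u)
  case Nil
  then show ?case by (cases u) auto
next
  case (Cons a w)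
  let ?n = "length w"
  have at_n: "Poly_Mapping.lookup (full_monomial (a # w)) ?n = a"
    by (simp add: lookup_add lookup_full_monomial)
  with Cons.prems have nz: "full_monomial (a # w) \<noteq> 0" by auto
  show ?case
  proof (cases u)
    case Nil
    then show ?thesis using nz by (simp add: lookup_one)
  next
    case (Cons b v)
    have 1: "Poly_Mapping.lookup (trunc_qsym ?n u) (full_monomial (a # w)) = 0"
      using keys_trunc_qsym[of "full_monomial (a # w)" ?n u ?n] at_n Cons.prems
      by (auto simp: in_keys_iff)
    have "Poly_Mapping.lookup (var ?n b * trunc_qsym ?n v) (full_monomial (a # w)) =
      (\<Sum>r\<in>Poly_Mapping.keys (trunc_qsym ?n v). if r = full_monomial w then (if a = b then Poly_Mapping.lookup (trunc_qsym ?n v) r else 0) else 0)"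
      unfolding var_def lookup_single_mult
    proof (rule sum.cong)
      fix r assume r: "r \<in> Poly_Mapping.keys (trunc_qsym ?n v)"
      have "a = b" if "Poly_Mapping.single ?n b + r = full_monomial (a # w)"
        using arg_cong[OF that, of "\<lambda>x. Poly_Mapping.lookup x ?n"] at_n keys_trunc_qsym[OF r, of ?n]
        by (simp add: lookup_add)
      then show "(if Poly_Mapping.single ?n b + r = full_monomial (a # w) then Poly_Mapping.lookup (trunc_qsym ?n v) r else 0)
        = (if r = full_monomial w then (if a = b then Poly_Mapping.lookup (trunc_qsym ?n v) r else 0) else 0)"
        by auto
    qed simp
    also have "\<dots> = (if a = b then Poly_Mapping.lookup (trunc_qsym ?n v) (full_monomial w) else 0)"
      by (auto simp: in_keys_iff)
    finally have 2: "Poly_Mapping.lookup (var ?n b * trunc_qsym ?n v) (full_monomial (a # w)) =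
      (if a = b then if v = w then 1 else 0 else 0)" using Cons.IH[of v] Cons.prems by simp
    from 1 2 show ?thesis using Cons by (auto simp: lookup_add)
  qed
qed

definition word_coeff :: "(nat \<Rightarrow> (nat \<Rightarrow>\<^sub>0 'c::comm_monoid_add) \<Rightarrow>\<^sub>0 int) \<Rightarrow> 'c list \<Rightarrow> int" where
  "word_coeff t w = Poly_Mapping.lookup (t (length w)) (full_monomial w)"

lemma word_coeff_zero [simp]: "word_coeff 0 w = 0"
  by (simp add: word_coeff_def)

lemma word_coeff_sum: "word_coeff (\<Sum>i\<in>I. t i) w = (\<Sum>i\<in>I. word_coeff (t i) w)"
  by (simp add: word_coeff_def sum_fun_apply lookup_sum)

lemma lookup_of_int_mult: "Poly_Mapping.lookup (of_int c * p) x = c * Poly_Mapping.lookup p x"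
  for p :: "'a::monoid_add \<Rightarrow>\<^sub>0 int"
proof -
  have "of_int c * p = scale c p"
    using mult_map_scale_conv_mult[of c p] by (simp add: scale_def flip: single_of_int)
  then show ?thesis by simp
qed

lemma word_coeff_of_int_mult: "word_coeff (of_int c * t) w = c * word_coeff t w"
  by (simp add: word_coeff_def of_int_fun_apply lookup_of_int_mult)

lemma word_coeff_realise:
  fixes f :: "'s \<Rightarrow> 'c::cancel_comm_monoid_add"
  assumes "0 \<notin> set w"
  shows "word_coeff (realise lam f p) w =
    (\<Sum>u\<in>Poly_Mapping.keys p. if map f u = w then lam ^ length w * Poly_Mapping.lookup p u else 0)"
proof -
  have "word_coeff (qsym lam f u) w = (if map f u = w then lam ^ length w else 0)" for u
    unfolding word_coeff_def qsym_def lookup_of_int_mult lookup_trunc_qsym_full_monomial[OF assms] by auto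
  then show ?thesis
    by (auto simp: realise_def lin_ext_def word_coeff_sum word_coeff_of_int_mult intro!: sum.cong)
qed

lemma word_coeff_realise_id:
  fixes p :: "'c::cancel_comm_monoid_add list \<Rightarrow>\<^sub>0 int"
  assumes "0 \<notin> set w"
  shows "word_coeff (realise 1 id p) w = Poly_Mapping.lookup p w"
  using word_coeff_realise[OF assms, of 1 id p] by (auto simp: in_keys_iff)

text \<open>
  A word can be read off from the monomial that contains as many variables as possible.
\<close>

lemma realise_inj:
  fixes f :: "'s \<Rightarrow> 'c::cancel_comm_monoid_add"
  assumes S: "inj_on f S" "\<And>a. a \<in> S \<Longrightarrow> f a \<noteq> 0" and "lam \<noteq> 0"
    and "Poly_Mapping.keys p \<subseteq> lists S" "Poly_Mapping.keys q \<subseteq> lists S" "realise lam f p = realise lam f q"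
  shows "p = q"
proof -
  have d: "realise lam f (p - q) = 0" using assms by (simp add: realise_def lin_ext_diff)
  have k: "Poly_Mapping.keys (p - q) \<subseteq> lists S" 
    using assms keys_diff[of p q] by blast
  have "Poly_Mapping.lookup (p - q) v = 0" for v
  proof (rule ccontr)
    assume nz: "Poly_Mapping.lookup (p - q) v \<noteq> 0"
    then have v: "v \<in> Poly_Mapping.keys (p - q)" by (simp add: in_keys_iff)
    then have vS: "v \<in> lists S" using k by auto
    have "0 \<notin> set (map f v)" using S vS by (auto simp: in_lists_conv_set)
    then have "0 = (\<Sum>u\<in>Poly_Mapping.keys (p - q). if map f u = map f v 
        then lam ^ length (map f v) * Poly_Mapping.lookup (p - q) u else 0)"
      using word_coeff_realise[of "map f v" lam f "p - q"] d by simp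
    also have "\<dots> = (\<Sum>u\<in>Poly_Mapping.keys (p - q). if u = v then lam ^ length v * Poly_Mapping.lookup (p - q) v else 0)"
    proof (rule sum.cong)
      fix u assume "u \<in> Poly_Mapping.keys (p - q)"
      then have "u \<in> lists S" using k by auto
      then have "map f u = map f v \<longleftrightarrow> u = v" 
        using vS inj_on_map_eq_map[of f u v] S(1) by (auto simp: in_lists_conv_set intro: inj_on_subset)
      then show "(if map f u = map f v then lam ^ length (map f v) * Poly_Mapping.lookup (p - q) u else 0)
        = (if u = v then lam ^ length v * Poly_Mapping.lookup (p - q) v else 0)" by auto
    qed simp
    also have "\<dots> = lam ^ length v * Poly_Mapping.lookup (p - q) v"
      using v by simp
    finally show False using nz \<open>lam \<noteq> 0\<close> by simp
  qed
  then have "p - q = 0" by (intro poly_mapping_eqI) simp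
  then show ?thesis by simp
qed

section \<open>Generated subrings\<close>

inductive_set ring_closure :: "'r::comm_ring_1 set \<Rightarrow> 'r set" for G where
  gen: "x \<in> G \<Longrightarrow> x \<in> ring_closure G"
| one: "1 \<in> ring_closure G"
| diff: "x \<in> ring_closure G \<Longrightarrow> y \<in> ring_closure G \<Longrightarrow> x - y \<in> ring_closure G"
| mult: "x \<in> ring_closure G \<Longrightarrow> y \<in> ring_closure G \<Longrightarrow> x * y \<in> ring_closure G"

lemma ring_closure_zero: "0 \<in> ring_closure G"
  using ring_closure.diff[OF ring_closure.one ring_closure.one] by simp

lemma ring_closure_uminus: "x \<in> ring_closure G \<Longrightarrow> - x \<in> ring_closure G"
  using ring_closure.diff[OF ring_closure_zero] by simp

lemma ring_closure_add: "x \<in> ring_closure G \<Longrightarrow> y \<in> ring_closure G \<Longrightarrow> x + y \<in> ring_closure G"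
  using ring_closure.diff[of x G "- y"] ring_closure_uminus[of y G] by simp

lemma ring_closure_sum: "(\<And>i. i \<in> I \<Longrightarrow> x i \<in> ring_closure G) \<Longrightarrow> sum x I \<in> ring_closure G"
  by (induction I rule: infinite_finite_induct) (auto intro: ring_closure_zero ring_closure_add)

lemma ring_closure_of_int: "of_int c \<in> ring_closure G"
proof -
  have "of_nat n \<in> ring_closure G" for n
    by (induction n) (auto intro: ring_closure_zero ring_closure_add ring_closure.one)
  then show ?thesis by (cases c) (auto intro: ring_closure_uminus simp del: of_nat_Suc)
qed

lemma ring_closure_subset: "G \<subseteq> ring_closure H \<Longrightarrow> ring_closure G \<subseteq> ring_closure H"
proof
  fix x assume "G \<subseteq> ring_closure H" "x \<in> ring_closure G"
  from this(2,1) show "x \<in> ring_closure H"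
    by (induction rule: ring_closure.induct) (auto intro: ring_closure.intros)
qed

lemma lin_ext_in_ring_closure:
  assumes "\<And>w. w \<in> Poly_Mapping.keys p \<Longrightarrow> g w \<in> ring_closure G"
  shows "lin_ext g p \<in> ring_closure G"
  unfolding lin_ext_def by (intro ring_closure_sum ring_closure.mult ring_closure_of_int assms)

section \<open>Elementary symmetric functions of powers\<close>

no_notation vec_index (infixl \<open>$\<close> 100)
unbundle fps_syntax

text \<open>
  The elementary symmetric functions of the entries of a list, read off from \<open>\<Prod> (1 + y * t)\<close>.
\<close>

definition esym :: "nat \<Rightarrow> 'r::comm_ring_1 list \<Rightarrow> 'r" where
  "esym k ys = (\<Prod>y\<leftarrow>ys. 1 + fps_const y * fps_X) $ k"

lemma esym_0 [simp]: "esym 0 ys = 1"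
  by (induction ys) (auto simp: esym_def)

lemma esym_Nil: "esym k [] = (if k = 0 then 1 else 0)"
  by (simp add: esym_def)

lemma esym_Cons: "esym k (y # ys) = esym k ys + (if k = 0 then 0 else y * esym (k - 1) ys)"
proof -
  have "(1 + fps_const y * fps_X) * f = f + fps_X * (fps_const y * f)" for f :: "'a fps"
    by (simp add: algebra_simps)
  then show ?thesis by (auto simp: esym_def)
qed

lemma esym_append: "esym k (xs @ ys) = (\<Sum>j=0..k. esym j xs * esym (k - j) ys)"
  by (simp add: esym_def fps_mult_nth)

lemma esym_map_mult: "esym k (map ((*) c) ys) = c ^ k * esym k ys"
proof (induction ys arbitrary: k)
  case (Cons y ys)
  show ?case unfolding list.map esym_Cons Cons by (cases k) (auto simp: algebra_simps)
qed (simp add: esym_Nil)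

text \<open>
  Over \<open>R[[s]]\<close> with \<open>s = t^n\<close>, the ring \<open>R[[t]]\<close> is free with basis \<open>1, t, \<dots>, t^(n-1)\<close>. This is the
  matrix of multiplication by \<open>\<Sum> c\<^sub>k t^k\<close> in that basis, so its determinant is a norm.
\<close>

definition mult_matrix :: "nat \<Rightarrow> (nat \<Rightarrow> 'r::comm_ring_1) \<Rightarrow> 'r fps mat" where
  "mult_matrix n c = mat n n (\<lambda>(i, j). Abs_fps (\<lambda>q. if j \<le> n * q + i then c (n * q + i - j) else 0))"

text \<open>
  Multiplication by \<open>1 + y * t\<close>. The corner entry \<open>y * s\<close> expresses \<open>t * t^(n-1) = s\<close>. The three cases are
  summed because for \<open>n = 1\<close> the corner lies on the diagonal.
\<close>

definition mult_matrix_linear :: "nat \<Rightarrow> 'r::comm_ring_1 \<Rightarrow> 'r fps mat" where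
  "mult_matrix_linear n y = mat n n (\<lambda>(i, j). (if i = j then 1 else 0) +
     (if i = Suc j then fps_const y else 0) + (if i = 0 \<and> Suc j = n then fps_const y * fps_X else 0))"

lemma mult_matrix_Nil:
  assumes "n > 0"
  shows "mult_matrix n (\<lambda>k. esym k []) = 1\<^sub>m n"
proof (rule eq_matI)
  fix i j assume "i < dim_row (1\<^sub>m n :: 'a fps mat)" "j < dim_col (1\<^sub>m n :: 'a fps mat)"
  then have ij: "i < n" "j < n" by auto
  \<comment> \<open>Division with remainder: \<open>i\<close> and \<open>j\<close> are below \<open>n\<close>.\<close>
  have "n * q + i = j \<longleftrightarrow> q = 0 \<and> i = j" for q
    using ij by (cases q) auto
  then have "(if j \<le> n * q + i then esym (n * q + i - j) [] else 0) = (if i = j then 1 else 0 :: 'a fps) $ q" for q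
    by (auto simp: esym_Nil)
  then show "mult_matrix n (\<lambda>k. esym k []) $$ (i, j) = (1\<^sub>m n :: 'a fps mat) $$ (i, j)"
    using ij by (auto simp: mult_matrix_def fps_eq_iff)
qed (auto simp: mult_matrix_def)

lemma mult_matrix_Cons:
  assumes "n > 0"
  shows "mult_matrix n (\<lambda>k. esym k (y # ys)) = mult_matrix_linear n y * mult_matrix n (\<lambda>k. esym k ys)"
proof (rule eq_matI)
  let ?c = "\<lambda>k. esym k ys"
  define D where "D i j = Abs_fps (\<lambda>q. if j \<le> n * q + i then ?c (n * q + i - j) else 0)" for i j
  fix i j assume "i < dim_row (mult_matrix_linear n y * mult_matrix n ?c)" "j < dim_col (mult_matrix_linear n y * mult_matrix n ?c)"
  then have ij: "i < n" "j < n" by (auto simp: mult_matrix_linear_def mult_matrix_def)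
  have "(mult_matrix_linear n y * mult_matrix n ?c) $$ (i, j) =
    (\<Sum>l\<in>{0..<n}. ((if i = l then 1 else 0) + (if i = Suc l then fps_const y else 0) 
      + (if i = 0 \<and> Suc l = n then fps_const y * fps_X else 0)) * D l j)"
    using ij by (simp add: mult_matrix_linear_def mult_matrix_def scalar_prod_def D_def)
  also have "\<dots> = (\<Sum>l\<in>{0..<n}. if l = i then D i j else 0)
     + (\<Sum>l\<in>{0..<n}. if l = i - 1 then (if i = 0 then 0 else fps_const y * D (i - 1) j) else 0) 
     + (\<Sum>l\<in>{0..<n}. if l = n - 1 then (if i = 0 then fps_const y * fps_X * D (n - 1) j else 0) else 0)"
    unfolding sum.distrib[symmetric]
    by (rule sum.cong) (use assms in \<open>auto simp: algebra_simps\<close>)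
  also have "\<dots> = D i j + (if i = 0 then 0 else fps_const y * D (i - 1) j)
     + (if i = 0 then fps_const y * fps_X * D (n - 1) j else 0)"
    using ij by auto
  finally have rhs: "(mult_matrix_linear n y * mult_matrix n ?c) $$ (i, j) = \<dots>" .
  have lhs: "mult_matrix n (\<lambda>k. esym k (y # ys)) $$ (i, j) =
      Abs_fps (\<lambda>q. if j \<le> n * q + i then esym (n * q + i - j) (y # ys) else 0)"
    using ij by (simp add: mult_matrix_def)
  show "mult_matrix n (\<lambda>k. esym k (y # ys)) $$ (i, j) = (mult_matrix_linear n y * mult_matrix n ?c) $$ (i, j)"
    unfolding lhs rhs
  proof (rule fps_ext)
    fix q
    show "Abs_fps (\<lambda>q. if j \<le> n * q + i then esym (n * q + i - j) (y # ys) else 0) $ q =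
      (D i j + (if i = 0 then 0 else fps_const y * D (i - 1) j)
     + (if i = 0 then fps_const y * fps_X * D (n - 1) j else 0)) $ q"
    proof (cases i)
      case (Suc i')
      then show ?thesis by (auto simp: D_def esym_Cons Suc_diff_le)
    next
      case 0
      show ?thesis
      proof (cases q)
        case 0
        then show ?thesis using \<open>i = 0\<close> by (auto simp: D_def esym_Cons mult.assoc)
      next
        case (Suc q')
        have "n * q' + n - Suc 0 - j = n * q' + n - j - 1" by simp
        moreover have "j \<le> n * q' + (n - 1)" using ij by linarith
        ultimately show ?thesis using \<open>i = 0\<close> Suc ij assms
          by (auto simp: D_def esym_Cons mult.assoc add_ac)
      qed
    qed
  qed
qed (auto simp: mult_matrix_linear_def mult_matrix_def)

text \<open>
  The norm of \<open>1 + y * t\<close>. The first row has only two nonzero entries, and both minors are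
  triangular.
\<close>

lemma det_mult_matrix_linear:
  assumes "n > 0"
  shows "det (mult_matrix_linear n y) = 1 + fps_const (- ((- y) ^ n)) * fps_X"
proof (cases "n = 1")
  case True
  then show ?thesis
    by (simp add: mult_matrix_linear_def det_single)
next
  case False
  let ?A = "mult_matrix_linear n y"
  have A: "?A \<in> carrier_mat n n" by (simp add: mult_matrix_linear_def)
  have n: "n > 1" using False assms by simp
  have "det ?A = (\<Sum>j<n. ?A $$ (0, j) * cofactor ?A 0 j)"
    using laplace_expansion_row[OF A, of 0] assms by simp
  also have "\<dots> = (\<Sum>j<n. (if j = 0 then cofactor ?A 0 0 else 0)
      + (if j = n - 1 then fps_const y * fps_X * cofactor ?A 0 (n - 1) else 0))"
    by (rule sum.cong) (use n in \<open>auto simp: mult_matrix_linear_def\<close>)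
  also have "\<dots> = cofactor ?A 0 0 + fps_const y * fps_X * cofactor ?A 0 (n - 1)"
    using n by (simp add: sum.distrib)
  also have "cofactor ?A 0 0 = 1"
  proof -
    have "det (mat_delete ?A 0 0) = prod_list (diag_mat (mat_delete ?A 0 0))"
      by (rule det_lower_triangular[of "n - 1"])
         (auto simp: mat_delete_def mult_matrix_linear_def)
    also have "diag_mat (mat_delete ?A 0 0) = map (\<lambda>i. 1) [0..<n - 1]"
      by (auto simp: diag_mat_def mat_delete_def mult_matrix_linear_def)
    finally show ?thesis by (simp add: cofactor_def map_replicate_const)
  qed
  also have "cofactor ?A 0 (n - 1) = fps_const ((- y) ^ (n - 1))"
  proof -
    have "det (mat_delete ?A 0 (n - 1)) = prod_list (diag_mat (mat_delete ?A 0 (n - 1)))"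
      by (rule det_upper_triangular)
         (auto simp: mat_delete_def mult_matrix_linear_def)
    also have "diag_mat (mat_delete ?A 0 (n - 1)) = map (\<lambda>i. fps_const y) [0..<n - 1]"
      by (auto simp: diag_mat_def mat_delete_def mult_matrix_linear_def)
    finally have "cofactor ?A 0 (n - 1) = (- 1) ^ (n - 1) * fps_const y ^ (n - 1)"
      by (simp add: cofactor_def map_replicate_const)
    then show ?thesis by (simp only: power_mult_distrib[symmetric]) simp
  qed
  also have "1 + fps_const y * fps_X * fps_const ((- y) ^ (n - 1)) = 1 + fps_const (- ((- y) ^ n)) * fps_X"
    using assms by (cases n) (auto simp: algebra_simps simp flip: fps_const_mult)
  finally show ?thesis .
qed

text \<open>
  The norm is multiplicative, so the norm of \<open>\<Prod> (1 + y * t)\<close> is, up to signs, \<open>\<Prod> (1 + y^n * s)\<close>. Thus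
  the elementary symmetric functions of the \<open>n\<close>-th powers are coefficients of a determinant whose
  entries are built from the elementary symmetric functions of the \<open>y\<close> themselves.
\<close>

lemma det_mult_matrix:
  assumes "n > 0"
  shows "det (mult_matrix n (\<lambda>k. esym k ys)) $ r = (- ((- 1) ^ n)) ^ r * esym r (map (\<lambda>y. y ^ n) ys)"
proof -
  have c: "mult_matrix n c \<in> carrier_mat n n" "mult_matrix_linear n y \<in> carrier_mat n n" for c and y :: 'a
    by (auto simp: mult_matrix_def mult_matrix_linear_def)
  have "det (mult_matrix n (\<lambda>k. esym k ys)) = (\<Prod>y\<leftarrow>ys. 1 + fps_const (- ((- y) ^ n)) * fps_X)"
    by (induction ys) (use assms in \<open>simp_all add: mult_matrix_Nil mult_matrix_Cons det_mult[OF c(2) c(1)] det_mult_matrix_linear\<close>)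
  also have "\<dots> $ r = esym r (map ((*) (- ((- 1) ^ n))) (map (\<lambda>y. y ^ n) ys))"
    by (simp add: esym_def o_def flip: power_mult_distrib)
  finally show ?thesis by (simp only: esym_map_mult)
qed

lemma ring_closure_fps_prod:
  assumes "\<And>i q. i \<in> I \<Longrightarrow> f i $ q \<in> ring_closure G"
  shows "prod f I $ q \<in> ring_closure G"
  using assms
proof (induction I arbitrary: q rule: infinite_finite_induct)
  case (insert i I)
  then show ?case by (auto simp: fps_mult_nth intro!: ring_closure_sum ring_closure.mult)
qed (auto intro: ring_closure_zero ring_closure.one)

lemma ring_closure_det:
  assumes A: "A \<in> carrier_mat n n"
    and entries: "\<And>i j q. i < n \<Longrightarrow> j < n \<Longrightarrow> A $$ (i, j) $ q \<in> ring_closure G"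
  shows "det A $ r \<in> ring_closure G"
proof -
  have "(\<Prod>i=0..<n. A $$ (i, p i)) $ q \<in> ring_closure G" if "p permutes {0..<n}" for p q
    using that permutes_in_image[OF that] by (intro ring_closure_fps_prod entries) auto
  then show ?thesis
    unfolding det_def'[OF A] fps_sum_nth
    by (auto intro!: ring_closure_sum simp: sign_def ring_closure_uminus)
qed

lemma fps_apply_hom:
  "comm_ring_hom (\<lambda>f :: ('i \<Rightarrow> 'r::comm_ring_1) fps. Abs_fps (\<lambda>q. (f $ q) m))"
proof -
  have sum_apply: "sum g I m = (\<Sum>i\<in>I. g i m)" for g :: "nat \<Rightarrow> 'i \<Rightarrow> 'r" and I
    by (induction I rule: infinite_finite_induct) auto
  show ?thesis
    by unfold_locales (auto simp: fps_eq_iff fps_mult_nth sum_apply)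
qed

text \<open>
  The elementary symmetric functions of \<open>n\<close>-th powers are integer polynomials in the elementary
  symmetric functions, and the polynomial does not depend on the number of arguments. To express this
  uniformity, \<open>c\<close> and \<open>d\<close> collect the values for all argument lists \<open>ys m\<close> at once as functions of \<open>m\<close>;
  the determinant is taken over the ring of such functions.
\<close>

lemma esym_power_in_ring_closure:
  fixes c :: "nat \<Rightarrow> 'i \<Rightarrow> 'r::comm_ring_1" and ys :: "'i \<Rightarrow> 'r list"
  assumes "n > 0" and c: "\<And>k m. c k m = esym k (ys m)"
    and d: "\<And>m. d m = esym r (map (\<lambda>y. y ^ n) (ys m))"
  shows "d \<in> ring_closure (range c)"
proof -
  have "(det (mult_matrix n c) $ r) m = (- ((- 1) ^ n)) ^ r * d m" for m
  proof -
    interpret comm_ring_hom "\<lambda>f :: ('i \<Rightarrow> 'r) fps. Abs_fps (\<lambda>q. (f $ q) m)" by (rule fps_apply_hom)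
    have "map_mat (\<lambda>f. Abs_fps (\<lambda>q. (f $ q) m)) (mult_matrix n c) = mult_matrix n (\<lambda>k. esym k (ys m))"
      by (rule eq_matI) (auto simp: mult_matrix_def fps_eq_iff c)
    then show ?thesis
      using hom_det[of "mult_matrix n c"] det_mult_matrix[OF \<open>n > 0\<close>, of "ys m" r] d
      by (metis fps_nth_Abs_fps)
  qed
  moreover have sgn: "(- ((- 1) ^ n)) ^ r = (1 :: 'i \<Rightarrow> 'r) \<and> (- ((- 1) ^ n)) ^ r = (1 :: 'r) \<or>
      (- ((- 1) ^ n)) ^ r = (- 1 :: 'i \<Rightarrow> 'r) \<and> (- ((- 1) ^ n)) ^ r = (- 1 :: 'r)"
    by (cases "even n"; cases "even r") auto
  ultimately have "det (mult_matrix n c) $ r = (- ((- 1) ^ n)) ^ r * d"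
    using sgn by (auto simp: fun_eq_iff)
  moreover have "det (mult_matrix n c) $ r \<in> ring_closure (range c)"
    by (rule ring_closure_det[of _ n])
       (auto simp: mult_matrix_def intro: ring_closure.gen ring_closure_zero)
  ultimately show ?thesis
    using ring_closure_uminus sgn by fastforce
qed

section \<open>Lyndon words\<close>

lemma append_less_append_iff: "x @ p < x @ q \<longleftrightarrow> p < q"
  for x p q :: "'a::linorder list"
  by (induction x) auto

lemma append_le_append_iff: "x @ p \<le> x @ q \<longleftrightarrow> p \<le> q"
  for x p q :: "'a::linorder list"
  by (induction x) auto

text \<open>
  A word that is smaller without being a proper prefix differs at some position, so anything may be
  appended on either side. This is the form in which the order of Lyndon words is used.
\<close>

lemma less_append_if_not_longer:
  fixes x y :: "'a::linorder list"
  assumes "x < y" "length y \<le> length x"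
  shows "x @ p < y @ q"
  using assms
proof (induction x arbitrary: y)
  case Nil
  then show ?case by simp
next
  case (Cons a x)
  then show ?case by (cases y) auto
qed

lemma append_less_cases:
  fixes x y z :: "'a::linorder list"
  assumes "x @ z < y"
  shows "(\<exists>y'. y = x @ y' \<and> z < y') \<or> (\<forall>p q. x @ p < y @ q)"
  using assms
proof (induction x arbitrary: y)
  case Nil
  then show ?case by simp
next
  case (Cons a x)
  then show ?case by (cases y) auto
qed

definition lyndon :: "'a::linorder list \<Rightarrow> bool" where
  "lyndon w \<longleftrightarrow> w \<noteq> [] \<and> (\<forall>u v. w = u @ v \<longrightarrow> u \<noteq> [] \<longrightarrow> v \<noteq> [] \<longrightarrow> w < v)"

lemma lyndon_nonempty: "lyndon w \<Longrightarrow> w \<noteq> []"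
  by (simp add: lyndon_def)

lemma lyndon_less_suffix:
  "lyndon (u @ v) \<Longrightarrow> u \<noteq> [] \<Longrightarrow> v \<noteq> [] \<Longrightarrow> u @ v < v"
  unfolding lyndon_def by blast

lemma lyndon_singleton: "lyndon [a]"
  by (auto simp: lyndon_def Cons_eq_append_conv)

text \<open>
  The only delicate point is that the product is smaller than its own right factor \<open>v\<close>. If \<open>u\<close> is a
  prefix of \<open>v\<close>, say \<open>v = u @ v'\<close>, this is because \<open>v < v'\<close>.
\<close>

lemma lyndon_append:
  assumes u: "lyndon u" and v: "lyndon v" and "u < v"
  shows "lyndon (u @ v)"
proof -
  have uvv: "u @ v < v"
  proof -
    from \<open>u < v\<close> have "u @ [] < v" by simp
    from append_less_cases[OF this] show ?thesis
    proof
      assume "\<exists>v'. v = u @ v' \<and> [] < v'"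
      then obtain v' where v': "v = u @ v'" "v' \<noteq> []" by auto
      have "u @ v' < v'"
        using lyndon_less_suffix[of u v'] v v' u lyndon_nonempty by auto
      then show ?thesis using v' by (simp add: append_less_append_iff)
    next
      assume "\<forall>p q. u @ p < v @ q"
      then show ?thesis by (metis append_Nil2)
    qed
  qed
  show ?thesis
    unfolding lyndon_def
  proof (intro conjI allI impI)
    show "u @ v \<noteq> []" using u lyndon_nonempty by auto
  next
    fix x y assume xy: "u @ v = x @ y" "x \<noteq> []" "y \<noteq> []"
    from xy(1) consider (1) z where "u = x @ z" "z @ v = y" | (2) z where "u @ z = x" "v = z @ y"
      by (auto simp: append_eq_append_conv2)
    then show "u @ v < y"
    proof cases
      case 1
      show ?thesis
      proof (cases "z = []")
        case True
        then show ?thesis using 1 uvv by simp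
      next
        case False
        then have "x @ z < z" using 1 u xy lyndon_less_suffix[of x z] by auto
        then have "(x @ z) @ v < z @ v" by (rule less_append_if_not_longer) simp
        then show ?thesis using 1 by simp
      qed
    next
      case 2
      show ?thesis
      proof (cases "z = []")
        case True
        then show ?thesis using 2 uvv by simp
      next
        case False
        then have "v < y" using 2 v xy lyndon_less_suffix[of z y] by auto
        then show ?thesis using uvv by simp
      qed
    qed
  qed
qed

section \<open>Unique factorization into Lyndon words, and shuffles\<close>

text \<open>
  A multiset of Lyndon words is encoded by the concatenation of its elements in decreasing order.
  The Chen--Fox--Lyndon theorem, proved below, says that this reaches every word exactly once.
\<close>

definition desc_concat :: "'a::linorder list multiset \<Rightarrow> 'a list" where
  "desc_concat Q = concat (rev (sorted_list_of_multiset Q))"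

lemma desc_concat_empty [simp]: "desc_concat {#} = []"
  by (simp add: desc_concat_def)

lemma desc_concat_single [simp]: "desc_concat {#v#} = v"
  by (simp add: desc_concat_def)

lemma desc_concat_union:
  assumes "\<And>s t. s \<in># S \<Longrightarrow> t \<in># T \<Longrightarrow> t \<le> s"
  shows "desc_concat (S + T) = desc_concat S @ desc_concat T"
proof -
  have "sorted_list_of_multiset (S + T) = sorted_list_of_multiset T @ sorted_list_of_multiset S"
  proof -
    have "sorted (sorted_list_of_multiset T @ sorted_list_of_multiset S)"
      using assms by (auto simp: sorted_append)
    then have "sort (sorted_list_of_multiset T @ sorted_list_of_multiset S)
        = sorted_list_of_multiset T @ sorted_list_of_multiset S"
      by (rule sorted_sort_id)
    moreover have "mset (sorted_list_of_multiset T @ sorted_list_of_multiset S) = S + T"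
      by simp
    ultimately show ?thesis
      by (metis sorted_list_of_multiset_mset)
  qed
  then show ?thesis by (simp add: desc_concat_def)
qed

lemma desc_concat_Max:
  assumes "v \<in># Q" "\<And>u. u \<in># Q \<Longrightarrow> u \<le> v"
  shows "desc_concat Q = v @ desc_concat (Q - {#v#})"
proof -
  have "desc_concat ({#v#} + (Q - {#v#})) = desc_concat {#v#} @ desc_concat (Q - {#v#})"
    by (rule desc_concat_union) (use assms in \<open>auto dest: in_diffD\<close>)
  then show ?thesis using assms by simp
qed

lemma desc_concat_Min:
  assumes "v \<in># Q" "\<And>u. u \<in># Q \<Longrightarrow> v \<le> u"
  shows "desc_concat Q = desc_concat (Q - {#v#}) @ v"
proof -
  have "desc_concat ((Q - {#v#}) + {#v#}) = desc_concat (Q - {#v#}) @ desc_concat {#v#}"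
    by (rule desc_concat_union) (use assms in \<open>auto dest: in_diffD\<close>)
  then show ?thesis using assms by simp
qed

lemma Max_mset:
  assumes "Q \<noteq> {#}"
  obtains v where "v \<in># Q" "\<And>u::'a::linorder. u \<in># Q \<Longrightarrow> u \<le> v"
  using Max_in[of "set_mset Q"] Max_ge[of "set_mset Q"] assms by (metis finite_set_mset set_mset_eq_empty_iff)

lemma Min_mset:
  assumes "Q \<noteq> {#}"
  obtains v where "v \<in># Q" "\<And>u::'a::linorder. u \<in># Q \<Longrightarrow> v \<le> u"
  using Min_in[of "set_mset Q"] Min_le[of "set_mset Q"] assms by (metis finite_set_mset set_mset_eq_empty_iff)

lemma set_desc_concat: "set (desc_concat Q) = (\<Union>v\<in>set_mset Q. set v)"
  by (simp add: desc_concat_def)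

lemma desc_concat_eq_Nil_iff:
  assumes "\<forall>v\<in>#Q. lyndon v"
  shows "desc_concat Q = [] \<longleftrightarrow> Q = {#}"
proof -
  have "v \<noteq> []" if "v \<in># Q" for v using that assms lyndon_nonempty by blast
  then have "desc_concat Q \<noteq> []" if "Q \<noteq> {#}"
    using that set_desc_concat[of Q] by fastforce
  then show ?thesis by auto
qed

text \<open>
  A new first letter is a Lyndon word; it swallows the largest factor as long as that factor is larger
  than it, and Lyndon words are closed under this operation.
\<close>

lemma lyndon_factorization_exists: "\<exists>Q. (\<forall>v\<in>#Q. lyndon v) \<and> desc_concat Q = w"
proof (induction w)
  case Nil
  show ?case by (rule exI[of _ "{#}"]) simp
next
  case (Cons a w)
  have merge: "\<exists>Q'. (\<forall>v\<in>#Q'. lyndon v) \<and> desc_concat Q' = u @ desc_concat Q"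
    if "lyndon u" "\<forall>v\<in>#Q. lyndon v" for u and Q :: "'a list multiset"
    using that
  proof (induction "size Q" arbitrary: u Q rule: less_induct)
    case less
    show ?case
    proof (cases "\<forall>v\<in>#Q. v \<le> u")
      case True
      then have "desc_concat ({#u#} + Q) = u @ desc_concat Q"
        by (subst desc_concat_union) auto
      then show ?thesis using less by (intro exI[of _ "{#u#} + Q"]) auto
    next
      case False
      then have "Q \<noteq> {#}" by auto
      then obtain v where v: "v \<in># Q" "\<And>x. x \<in># Q \<Longrightarrow> x \<le> v" by (rule Max_mset) blast
      with False have "u < v" by fastforce
      then have "lyndon (u @ v)" using less v by (auto intro: lyndon_append)
      moreover have "size (Q - {#v#}) < size Q" using v by (simp add: size_Diff1_less)
      ultimately have "\<exists>Q'. (\<forall>v\<in>#Q'. lyndon v) \<and> desc_concat Q' = (u @ v) @ desc_concat (Q - {#v#})"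
        using less.hyps[of "Q - {#v#}" "u @ v"] less.prems by (auto dest: in_diffD)
      then show ?thesis using desc_concat_Max[OF v] by simp
    qed
  qed
  from Cons obtain Q where "\<forall>v\<in>#Q. lyndon v" "desc_concat Q = w" by blast
  with merge[OF lyndon_singleton[of a], of Q] show ?case by auto
qed

text \<open>
  The smallest factor of the tail is a proper suffix of the Lyndon word, hence larger than the word.
\<close>

lemma lyndon_Cons_less_factors:
  assumes "lyndon (a # desc_concat Y)" "\<forall>y\<in>#Y. lyndon y" "y \<in># Y"
  shows "a # desc_concat Y < y"
proof -
  from assms(3) have "Y \<noteq> {#}" by auto
  then obtain m where m: "m \<in># Y" "\<And>u. u \<in># Y \<Longrightarrow> m \<le> u" by (rule Min_mset) blast
  have "(a # desc_concat (Y - {#m#})) @ m < m"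
    by (rule lyndon_less_suffix) (use assms m lyndon_nonempty desc_concat_Min[OF m] in auto)
  then show ?thesis using m desc_concat_Min[OF m] assms by fastforce
qed

text \<open>
  This is the heart of the triangularity of shuffle products. Cut the first letter \<open>a\<close> off a Lyndon
  word \<open>v\<close> and let \<open>Y\<close> be the factors of the rest. If no word \<open>k\<close> of \<open>R\<close> exceeds \<open>v\<close>, sorting \<open>Y\<close> into
  \<open>R\<close> puts all of \<open>Y\<close> first and nothing changes. Otherwise let \<open>m\<close> be the largest word of \<open>R\<close>. The right
  side begins with \<open>m\<close>, the left side with \<open>a\<close>, the factors \<open>G\<close> of \<open>Y\<close> that are at least \<open>m\<close>, and then
  \<open>m\<close>. Since \<open>v < m\<close>, either \<open>m\<close> wins within \<open>a\<close> and \<open>G\<close>, or \<open>a\<close> followed by \<open>G\<close> is a prefix of \<open>m\<close>,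
  and then the Lyndon word \<open>m\<close> has to be compared with its own proper suffix, which is larger.
\<close>

lemma Cons_desc_concat_le:
  assumes v: "lyndon (a # desc_concat Y)" and Y: "\<forall>y\<in>#Y. lyndon y" and R: "\<forall>k\<in>#R. lyndon k"
  shows "a # desc_concat (Y + R) \<le> desc_concat (add_mset (a # desc_concat Y) R)"
    and "k \<in># R \<Longrightarrow> a # desc_concat Y < k \<Longrightarrow>
      a # desc_concat (Y + R) < desc_concat (add_mset (a # desc_concat Y) R)"
proof -
  define v where "v = a # desc_concat Y"
  have vY: "v < y" if "y \<in># Y" for y
    using lyndon_Cons_less_factors[OF v Y that] by (simp add: v_def)
  have strict: "a # desc_concat (Y + R) < desc_concat (add_mset v R)" if k: "k \<in># R" "v < k" for k
  proof -
    from k have "R \<noteq> {#}" by auto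
    then obtain m where m: "m \<in># R" "\<And>u. u \<in># R \<Longrightarrow> u \<le> m" by (rule Max_mset) blast
    then have vm: "v < m" using k by fastforce
    \<comment> \<open>\<open>G\<close> and \<open>L\<close> are the factors that come before and after \<open>m\<close> in the sorted word.\<close>
    define G where "G = filter_mset (\<lambda>y. m \<le> y) Y"
    define L where "L = filter_mset (\<lambda>y. \<not> m \<le> y) Y"
    have YGL: "Y = G + L" by (simp add: G_def L_def)
    have cY: "desc_concat Y = desc_concat G @ desc_concat L"
      unfolding YGL by (rule desc_concat_union) (auto simp: G_def L_def)
    have "desc_concat (Y + R) = desc_concat (G + (L + R))"
      by (simp add: YGL add.assoc)
    also have "\<dots> = desc_concat G @ desc_concat (L + R)"
      by (rule desc_concat_union) (use m in \<open>fastforce simp: G_def L_def\<close>)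
    also have "desc_concat (L + R) = m @ desc_concat (L + R - {#m#})"
      by (rule desc_concat_Max) (use m in \<open>auto simp: L_def\<close>)
    finally have lhs: "desc_concat (Y + R) = desc_concat G @ m @ desc_concat (L + R - {#m#})" .
    have rhs: "desc_concat (add_mset v R) = m @ desc_concat (add_mset v R - {#m#})"
      by (rule desc_concat_Max) (use m vm in auto)
    have lm: "lyndon m" using R m by auto
    then obtain c k' where ck: "m = c # k'" using lyndon_nonempty by (cases m) auto
    from vm ck have "a < c \<or> a = c \<and> desc_concat G @ desc_concat L < k'"
      by (simp add: v_def cY)
    then show ?thesis
    proof
      assume "a < c"
      then show ?thesis using rhs ck by simp
    next
      assume ac: "a = c \<and> desc_concat G @ desc_concat L < k'"
      then have "desc_concat G @ m @ desc_concat (L + R - {#m#}) < k' @ desc_concat (add_mset v R - {#m#})"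
      proof -
        consider (1) k'' where "k' = desc_concat G @ k''" "desc_concat L < k''"
          | (2) "\<forall>p q. desc_concat G @ p < k' @ q"
          using append_less_cases[of "desc_concat G" "desc_concat L" k'] ac by blast
        then show ?thesis
        proof cases
          case 1
          then have "k'' \<noteq> []" by auto
          then have "m < k''"
            using lyndon_less_suffix[of "c # desc_concat G" k''] lm ck 1 by simp
          then have "m @ desc_concat (L + R - {#m#}) < k'' @ desc_concat (add_mset v R - {#m#})"
            by (rule less_append_if_not_longer) (simp add: ck 1)
          then show ?thesis by (simp add: append_less_append_iff 1)
        next
          case 2
          then show ?thesis by blast
        qed
      qed
      then show ?thesis using rhs lhs ck ac by simp
    qed
  qed
  show "a # desc_concat (Y + R) < desc_concat (add_mset (a # desc_concat Y) R)"
    if "k \<in># R" "a # desc_concat Y < k" for k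
    using strict that by (simp add: v_def)
  show "a # desc_concat (Y + R) \<le> desc_concat (add_mset (a # desc_concat Y) R)"
  proof (cases "\<exists>k\<in>#R. v < k")
    case True
    then show ?thesis using strict by (auto simp: v_def intro: less_imp_le)
  next
    case False
    then have R: "k \<le> v" if "k \<in># R" for k using that by fastforce
    have "desc_concat (Y + R) = desc_concat Y @ desc_concat R"
      by (rule desc_concat_union) (use vY R in fastforce)
    moreover have "desc_concat ({#v#} + R) = desc_concat {#v#} @ desc_concat R"
      by (rule desc_concat_union) (use vY R in fastforce)
    ultimately show ?thesis by (simp add: v_def)
  qed
qed

lemma desc_concat_Cons_split:
  assumes S: "\<forall>v\<in>#S. lyndon v" and eq: "desc_concat S = a # s"
  obtains Y S' where "\<forall>y\<in>#Y. lyndon y" "lyndon (a # desc_concat Y)" 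
    "S = add_mset (a # desc_concat Y) S'" "\<forall>v\<in>#S'. v \<le> a # desc_concat Y"
    "s = desc_concat (Y + S')"
proof -
  from eq have "S \<noteq> {#}" by auto
  then obtain m where m: "m \<in># S" "\<And>u. u \<in># S \<Longrightarrow> u \<le> m" by (rule Max_mset) blast
  have lm: "lyndon m" using S m by auto
  obtain Y where Y: "\<forall>y\<in>#Y. lyndon y" "desc_concat Y = tl m" 
    using lyndon_factorization_exists by blast
  have c: "desc_concat S = m @ desc_concat (S - {#m#})" by (rule desc_concat_Max[OF m])
  with eq lm have mY: "m = a # desc_concat Y" using Y lyndon_nonempty by (cases m) auto
  show ?thesis
  proof (rule that[of Y "S - {#m#}"])
    show "\<forall>v\<in>#S - {#m#}. v \<le> a # desc_concat Y" using m mY by (auto dest: in_diffD)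
    have "desc_concat (Y + (S - {#m#})) = desc_concat Y @ desc_concat (S - {#m#})"
      using lyndon_Cons_less_factors[of a Y] Y(1) lm mY m 
      by (intro desc_concat_union) (fastforce dest: in_diffD)
    then show "s = desc_concat (Y + (S - {#m#}))" using c eq mY by simp
  qed (use Y lm mY m in auto)
qed

text \<open>
  The first letter of a shuffle comes from the largest factor of one of the two words. By induction
  the remaining letters form at most the sorted word, and \<open>Cons_desc_concat_le\<close> puts the letter back.
\<close>

lemma shuffle_le_desc_concat:
  assumes "\<forall>v\<in>#S. lyndon v" "\<forall>v\<in>#T. lyndon v" "w \<in> shuffles (desc_concat S) (desc_concat T)"
  shows "w \<le> desc_concat (S + T)"
  using assms
proof (induction w arbitrary: S T)
  case Nil
  then show ?case by simp
next
  case (Cons a w)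
  have main: "a # w \<le> desc_concat (S + T)"
    if S: "\<forall>v\<in>#S. lyndon v" and T: "\<forall>v\<in>#T. lyndon v" and "desc_concat S = a # s"
      "w \<in> shuffles s (desc_concat T)" for S T s
  proof -
    obtain Y S' where Y: "\<forall>y\<in>#Y. lyndon y" "lyndon (a # desc_concat Y)" 
      "S = add_mset (a # desc_concat Y) S'" "s = desc_concat (Y + S')"
      using desc_concat_Cons_split[OF S \<open>desc_concat S = a # s\<close>] by metis
    have "w \<le> desc_concat (Y + S' + T)"
      using Cons.IH[of "Y + S'" T] Y S T that by auto
    then have "a # w \<le> a # desc_concat (Y + (S' + T))" by (simp add: add.assoc)
    also have "\<dots> \<le> desc_concat (add_mset (a # desc_concat Y) (S' + T))"
      by (rule Cons_desc_concat_le) (use Y S T in auto)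
    finally show ?thesis using Y by simp
  qed
  from Cons.prems(3) show ?case
    unfolding Cons_in_shuffles_iff
  proof (elim disjE conjE)
    assume "desc_concat S \<noteq> []" "hd (desc_concat S) = a" "w \<in> shuffles (tl (desc_concat S)) (desc_concat T)"
    then show ?thesis using main[OF Cons.prems(1,2), of "tl (desc_concat S)"] by (metis list.collapse)
  next
    assume "desc_concat T \<noteq> []" "hd (desc_concat T) = a" "w \<in> shuffles (desc_concat S) (tl (desc_concat T))"
    then show ?thesis using main[OF Cons.prems(2,1), of "tl (desc_concat T)"]
      by (metis list.collapse shuffles_commutes add.commute)
  qed
qed

text \<open>
  When all factors of the first word exceed those of the second, a shuffle that starts with a letter
  of the second word loses strictly. Hence the concatenation arises from a single shuffle.
\<close>

lemma Cons_shuffle_less_append: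
  assumes S: "\<forall>v\<in>#S. lyndon v" and T: "\<forall>v\<in>#T. lyndon v" 
    and ST: "\<And>s t. s \<in># S \<Longrightarrow> t \<in># T \<Longrightarrow> t < s" and "S \<noteq> {#}"
    and eq: "desc_concat T = b # t" and w: "w \<in> shuffles (desc_concat S) t"
  shows "b # w < desc_concat S @ desc_concat T"
proof -
  obtain Y T' where Y: "\<forall>y\<in>#Y. lyndon y" "lyndon (b # desc_concat Y)" 
      "T = add_mset (b # desc_concat Y) T'" "t = desc_concat (Y + T')"
    using desc_concat_Cons_split[OF T eq] by metis
  have "w \<le> desc_concat (S + (Y + T'))"
    using shuffle_le_desc_concat[of S "Y + T'" w] w S T Y by auto
  then have "b # w \<le> b # desc_concat (Y + (S + T'))"
    by (simp add: union_ac)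
  also obtain k where "k \<in># S" using \<open>S \<noteq> {#}\<close> by auto
  then have "b # desc_concat (Y + (S + T')) < desc_concat (add_mset (b # desc_concat Y) (S + T'))"
    using ST S T Y by (intro Cons_desc_concat_le(2)[where k = k]) auto
  also have "add_mset (b # desc_concat Y) (S + T') = S + T"
    using Y by simp
  also have "desc_concat (S + T) = desc_concat S @ desc_concat T"
    by (rule desc_concat_union) (use ST in fastforce)
  finally show ?thesis .
qed

text \<open>
  A nonempty suffix starts inside some factor, and a suffix of a Lyndon word is at least that word.
\<close>

lemma suffix_desc_concat_ge:
  assumes "\<forall>v\<in>#Q. lyndon v" "desc_concat Q = p @ s" "s \<noteq> []" "\<And>v. v \<in># Q \<Longrightarrow> m \<le> v"
  shows "m \<le> s"
  using assms
proof (induction "size Q" arbitrary: Q p rule: less_induct)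
  case less
  then have "Q \<noteq> {#}" by auto
  then obtain v where v: "v \<in># Q" "\<And>x. x \<in># Q \<Longrightarrow> x \<le> v" by (rule Max_mset) blast
  have c: "p @ s = v @ desc_concat (Q - {#v#})" using desc_concat_Max[OF v] less by simp
  from this consider (1) z where "v = p @ z" "s = z @ desc_concat (Q - {#v#})" 
    | (2) z where "p = v @ z" "desc_concat (Q - {#v#}) = z @ s"
    by (auto simp: append_eq_append_conv2)
  then show ?case
  proof cases
    case 1
    show ?thesis
    proof (cases "z = []")
      case True
      then show ?thesis
        using less.hyps[of "Q - {#v#}" "[]"] 1 less.prems v by (auto simp: size_Diff1_less dest: in_diffD)
    next
      case False
      then have "v \<le> z" using 1 lyndon_less_suffix[of p z] less.prems v by (cases "p = []") auto
      also have "z \<le> s" using 1 append_le_append_iff[of z "[]"] by simp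
      finally show ?thesis using less.prems v by fastforce
    qed
  next
    case 2
    then show ?thesis
      using less.hyps[of "Q - {#v#}" z] less.prems v by (auto simp: size_Diff1_less dest: in_diffD)
  qed
qed

text \<open>
  The smallest factor is determined by the word: it is the smallest nonempty suffix.
\<close>

lemma lyndon_factorization_unique:
  assumes "\<forall>v\<in>#Q. lyndon v" "\<forall>v\<in>#Q'. lyndon v" "desc_concat Q = desc_concat Q'"
  shows "Q = Q'"
  using assms
proof (induction "size Q" arbitrary: Q Q' rule: less_induct)
  case less
  show ?case
  proof (cases "Q = {#}")
    case True
    then show ?thesis using less.prems desc_concat_eq_Nil_iff[of Q'] by simp
  next
    case False
    then have False': "Q' \<noteq> {#}" using less.prems desc_concat_eq_Nil_iff[of Q] by auto
    obtain m where m: "m \<in># Q" "\<And>x. x \<in># Q \<Longrightarrow> m \<le> x" using False by (rule Min_mset) blast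
    obtain m' where m': "m' \<in># Q'" "\<And>x. x \<in># Q' \<Longrightarrow> m' \<le> x" using False' by (rule Min_mset) blast
    have "m \<noteq> []" "m' \<noteq> []" using less.prems m m' by (auto dest: lyndon_nonempty)
    have "m \<le> m'"
      using \<open>m' \<noteq> []\<close> suffix_desc_concat_ge[OF less.prems(1), of _ m' m] desc_concat_Min[OF m'] less.prems m m'
      by auto
    moreover have "m' \<le> m"
      using \<open>m \<noteq> []\<close> suffix_desc_concat_ge[OF less.prems(2), of _ m m'] desc_concat_Min[OF m] less.prems m m'
      by metis
    ultimately have "m = m'" by simp
    then have "Q - {#m#} = Q' - {#m#}"
      using less.hyps[of "Q - {#m#}" "Q' - {#m#}"] desc_concat_Min[OF m] desc_concat_Min[OF m'] less.prems m
      by (auto simp: size_Diff1_less dest: in_diffD)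
    then show ?thesis using m m' \<open>m = m'\<close> by (metis insert_DiffM)
  qed
qed

text \<open>
  Use the same pattern of interleaving for the larger words.
\<close>

lemma shuffle_mono:
  fixes u v u' v' :: "'a::linorder list"
  assumes "x \<in> shuffles u v" "length u' = length u" "length v' = length v" "u \<le> u'" "v \<le> v'"
  shows "\<exists>x'\<in>shuffles u' v'. x \<le> x' \<and> (x = x' \<longrightarrow> u = u' \<and> v = v')"
  using assms
proof (induction x arbitrary: u v u' v')
  case Nil
  then show ?case by simp
next
  case (Cons c x)
  have main: "\<exists>x'\<in>shuffles u' v'. c # x \<le> x' \<and> (c # x = x' \<longrightarrow> u = u' \<and> v = v')"
    if uv: "u = c # u1" "x \<in> shuffles u1 v" "length u' = length u" "length v' = length v" "u \<le> u'" "v \<le> v'"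
    for u v u' v' u1
  proof -
    obtain c' u1' where u': "u' = c' # u1'"
      using \<open>length u' = length u\<close> \<open>u = c # u1\<close> by (cases u') auto
    show ?thesis
    proof (cases "c = c'")
      case True
      then obtain x' where x': "x' \<in> shuffles u1' v'" "x \<le> x'" "x = x' \<longrightarrow> u1 = u1' \<and> v = v'"
        using Cons.IH[of u1 v u1' v'] uv u' by auto
      then show ?thesis
        using True that u' by (intro bexI[of _ "c # x'"]) (auto simp: Cons_in_shuffles_leftI)
    next
      case False
      then have "c < c'" using that u' by auto
      moreover have "c' # splice u1' v' \<in> shuffles u' v'" using u' by (auto intro: Cons_in_shuffles_leftI)
      ultimately show ?thesis by (intro bexI[of _ "c' # splice u1' v'"]) auto
    qed
  qed
  from Cons.prems(1) show ?case
    unfolding Cons_in_shuffles_iff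
  proof (elim disjE conjE)
    assume "u \<noteq> []" "hd u = c" "x \<in> shuffles (tl u) v"
    then show ?thesis using main[of u "tl u" v u' v'] Cons.prems by (metis list.collapse)
  next
    assume "v \<noteq> []" "hd v = c" "x \<in> shuffles u (tl v)"
    then show ?thesis using main[of v "tl v" u v' u'] Cons.prems
      by (metis list.collapse shuffles_commutes)
  qed
qed

section \<open>Elementary symmetric functions of words\<close>

text \<open>
  The \<open>n\<close>-th elementary symmetric function of the monomials that make up the quasi-symmetric function of
  \<open>w\<close>, as an element of the algebra. The monomials of \<open>a # w\<close> either begin with the newest variable \<open>x\<close>, and
  then have the form \<open>x\<^sup>a\<close> times a monomial of \<open>w\<close>, or they do not contain \<open>x\<close>. Choosing \<open>Suc j\<close> monomials of
  the first kind gives the recursion. The lemma \<open>realise_elem_sym\<close> confirms this description.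
\<close>

function elem_sym :: "nat \<Rightarrow> 'b multiset list \<Rightarrow> 'b multiset list \<Rightarrow>\<^sub>0 int" where
  "elem_sym 0 w = Poly_Mapping.single [] 1"
| "elem_sym (Suc n) [] = (if n = 0 then Poly_Mapping.single [] 1 else 0)"
| "elem_sym (Suc n) (a # w) = (\<Sum>j=0..n. prepend_letter (repeat_mset (Suc j) a)
     (mixable_shuffle 1 (elem_sym (Suc j) w) (elem_sym (n - j) (a # w))))"
  by pat_completeness auto
termination
  by (relation "inv_image (less_than <*lex*> less_than) (\<lambda>(n, w). (length w, n))") auto

text \<open>
  The words themselves are among these elements.
\<close>

lemma elem_sym_1: "elem_sym (Suc 0) w = Poly_Mapping.single w 1"
proof (induction w)
  case (Cons a w)
  show ?case
    by (simp add: Cons mixable_shuffle_def prepend_letter_def)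
qed simp

fun qsym_monomials :: "nat \<Rightarrow> 'c::comm_monoid_add list \<Rightarrow> ((nat \<Rightarrow>\<^sub>0 'c) \<Rightarrow>\<^sub>0 int) list" where
  "qsym_monomials m [] = [1]"
| "qsym_monomials 0 (a # w) = []"
| "qsym_monomials (Suc m) (a # w) =
     map ((*) (var m a)) (qsym_monomials m w) @ qsym_monomials m (a # w)"

lemma var_repeat_mset: "var m (repeat_mset k a) = var m a ^ k"
proof (induction k)
  case 0
  show ?case by (simp add: var_def)
next
  case (Suc k)
  have "repeat_mset (Suc k) a = a + repeat_mset k a" by simp
  then show ?case by (simp only: var_add Suc power_Suc)
qed

lemma realise_prepend_letter_0 [simp]: "realise lam f (prepend_letter a p) 0 = 0"
  by (simp add: realise_def lin_ext_fun_apply lin_ext_prepend_letter) (simp add: lin_ext_def)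

lemma realise_prepend_letter_Suc:
  "realise lam f (prepend_letter a p) (Suc m) =
    realise lam f (prepend_letter a p) m + of_int lam * var m (f a) * realise lam f p m"
  by (simp add: realise_def lin_ext_fun_apply lin_ext_qsym_Suc_prepend_letter)

lemma realise_sum: "realise lam f (\<Sum>i\<in>I. p i) m = (\<Sum>i\<in>I. realise lam f (p i) m)"
  by (simp add: realise_def lin_ext_sum sum_fun_apply)

text \<open>
  Both sides obey the same recursion in the number of variables.
\<close>

lemma realise_elem_sym: "realise 1 id (elem_sym k w) m = esym k (qsym_monomials m w)"
proof (induction m w arbitrary: k rule: qsym_monomials.induct)
  case (1 m)
  show ?case
    by (cases k) (auto simp: esym_Cons esym_Nil realise_def)
next
  case (2 a w)
  show ?case
    by (cases k) (auto simp: esym_Nil realise_sum)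
next
  case (3 m a w)
  show ?case
  proof (cases k)
    case 0
    then show ?thesis by simp
  next
    case (Suc n)
    have "realise 1 id (elem_sym k (a # w)) (Suc m) = realise 1 id (elem_sym k (a # w)) m +
      (\<Sum>j=0..n. var m a ^ Suc j * (esym (Suc j) (qsym_monomials m w) * esym (n - j) (qsym_monomials m (a # w))))"
      unfolding Suc elem_sym.simps realise_sum realise_prepend_letter_Suc sum.distrib
        realise_mixable_shuffle[of id, simplified] times_fun_def 3 id_apply var_repeat_mset
      by simp
    also have "\<dots> = esym (Suc n) (qsym_monomials m (a # w)) +
      (\<Sum>j=0..n. var m a ^ Suc j * esym (Suc j) (qsym_monomials m w) * esym (n - j) (qsym_monomials m (a # w)))"
      by (simp only: 3 Suc mult.assoc)
    also have "\<dots> = (\<Sum>j=0..Suc n. var m a ^ j * esym j (qsym_monomials m w) * esym (Suc n - j) (qsym_monomials m (a # w)))"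
      by (subst sum.atLeast0_atMost_Suc_shift) (simp only: o_def diff_Suc_Suc diff_zero esym_0 power_0 mult_1)
    also have "\<dots> = esym k (qsym_monomials (Suc m) (a # w))"
      by (simp only: Suc qsym_monomials.simps esym_append esym_map_mult)
    finally show ?thesis .
  qed
qed

lemma keys_sum_prepend_mixable_shuffle:
  assumes "x \<in> Poly_Mapping.keys (\<Sum>j\<in>I. prepend_letter (b j) (mixable_shuffle lam (f j) (g j)))"
  shows "\<exists>j u v y. j \<in> I \<and> x = b j # y \<and> u \<in> Poly_Mapping.keys (f j) \<and> v \<in> Poly_Mapping.keys (g j) \<and>
    y \<in> Poly_Mapping.keys (word_mixable_shuffle lam u v)"
proof -
  obtain j where j: "j \<in> I" "x \<in> Poly_Mapping.keys (prepend_letter (b j) (mixable_shuffle lam (f j) (g j)))"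
    using subsetD[OF keys_sum assms] by blast
  then obtain y where y: "x = b j # y" "y \<in> Poly_Mapping.keys (mixable_shuffle lam (f j) (g j))"
    by auto
  from subsetD[OF keys_mixable_shuffle y(2)] j(1) y(1) show ?thesis by blast
qed

lemma keys_elem_sym_Suc_Cons:
  assumes "x \<in> Poly_Mapping.keys (elem_sym (Suc n) (a # w))"
  obtains j u v y where "j \<le> n" "x = repeat_mset (Suc j) a # y"
    "u \<in> Poly_Mapping.keys (elem_sym (Suc j) w)" "v \<in> Poly_Mapping.keys (elem_sym (n - j) (a # w))"
    "y \<in> Poly_Mapping.keys (word_mixable_shuffle (1 :: int) u v)"
  using keys_sum_prepend_mixable_shuffle[OF assms[unfolded elem_sym.simps]]
  unfolding atLeast0AtMost atMost_iff by blast

lemma Suc_mult_plus_diff_mult: "j \<le> n \<Longrightarrow> Suc j * c + (n - j) * c = Suc n * c"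
  for c :: nat
  unfolding add_mult_distrib[symmetric] by simp

lemma keys_elem_sym_lists:
  assumes S: "\<And>a b. a \<in> S \<Longrightarrow> b \<in> S \<Longrightarrow> a + b \<in> S"
  shows "w \<in> lists S \<Longrightarrow> Poly_Mapping.keys (elem_sym n w) \<subseteq> lists S"
proof (induction n w rule: elem_sym.induct)
  case (3 n a w)
  have rep: "repeat_mset (Suc j) a \<in> S" for j
    by (induction j) (use 3 S in auto)
  show ?case
  proof
    fix x assume "x \<in> Poly_Mapping.keys (elem_sym (Suc n) (a # w))"
    then obtain j u v y where j: "j \<le> n" "x = repeat_mset (Suc j) a # y"
      "u \<in> Poly_Mapping.keys (elem_sym (Suc j) w)" "v \<in> Poly_Mapping.keys (elem_sym (n - j) (a # w))"
      "y \<in> Poly_Mapping.keys (word_mixable_shuffle (1 :: int) u v)"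
      by (rule keys_elem_sym_Suc_Cons)
    have "Poly_Mapping.keys (elem_sym (Suc j) w) \<subseteq> lists S"
      "Poly_Mapping.keys (elem_sym (n - j) (a # w)) \<subseteq> lists S"
      using 3(1)[of j] 3(2)[of j] 3(3) j(1) by simp_all
    then have "u \<in> lists S" "v \<in> lists S" using j by blast+
    then have "y \<in> lists S" using keys_word_mixable_shuffle_lists[OF S] j by blast
    then show "x \<in> lists S" unfolding j(2) using rep by (rule lists.Cons[rotated])
  qed
qed (auto split: if_splits)

lemma sum_list_elem_sym:
  "x \<in> Poly_Mapping.keys (elem_sym n w) \<Longrightarrow> sum_list x = repeat_mset n (sum_list w)"
proof (induction n w arbitrary: x rule: elem_sym.induct)
  case (3 n a w)
  from 3(3) obtain j u v y where j: "j \<le> n" "x = repeat_mset (Suc j) a # y"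
      "u \<in> Poly_Mapping.keys (elem_sym (Suc j) w)" "v \<in> Poly_Mapping.keys (elem_sym (n - j) (a # w))"
      "y \<in> Poly_Mapping.keys (word_mixable_shuffle (1 :: int) u v)"
      by (rule keys_elem_sym_Suc_Cons)
  have "sum_list x = repeat_mset (Suc j) a + (repeat_mset (Suc j) (sum_list w) + repeat_mset (n - j) (sum_list (a # w)))"
    using 3(1)[OF _ j(3)] 3(2)[OF _ j(4)] sum_list_word_mixable_shuffle[OF j(5)] j(1)
    by (simp only: j(2) sum_list.Cons atLeast0AtMost atMost_iff)
  also have "sum_list (a # w) = a + sum_list w" by simp
  also have "repeat_mset (Suc j) a + (repeat_mset (Suc j) (sum_list w) + repeat_mset (n - j) (a + sum_list w))
      = repeat_mset (Suc j) (a + sum_list w) + repeat_mset (n - j) (a + sum_list w)"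
    by (simp add: multiset_eq_iff algebra_simps)
  also have "\<dots> = repeat_mset (Suc n) (a + sum_list w)"
    using Suc_mult_plus_diff_mult[OF j(1)]
    by (simp only: multiset_eq_iff count_union count_repeat_mset) blast
  finally show ?case by simp
qed (auto split: if_splits)

lemma length_elem_sym:
  "x \<in> Poly_Mapping.keys (elem_sym n w) \<Longrightarrow> length x \<le> n * length w"
proof (induction n w arbitrary: x rule: elem_sym.induct)
  case (3 n a w)
  from 3(3) obtain j u v y where j: "j \<le> n" "x = repeat_mset (Suc j) a # y"
      "u \<in> Poly_Mapping.keys (elem_sym (Suc j) w)" "v \<in> Poly_Mapping.keys (elem_sym (n - j) (a # w))"
      "y \<in> Poly_Mapping.keys (word_mixable_shuffle (1 :: int) u v)"
      by (rule keys_elem_sym_Suc_Cons)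
  have "length x \<le> Suc (Suc j * length w + (n - j) * length (a # w))"
    using 3(1)[OF _ j(3)] 3(2)[OF _ j(4)] length_word_mixable_shuffle[OF j(5)] j(1,2) by simp
  also have "\<dots> \<le> Suc j * length (a # w) + (n - j) * length (a # w)" by simp
  also have "\<dots> = Suc n * length (a # w)" by (rule Suc_mult_plus_diff_mult[OF j(1)])
  finally show ?case .
qed (auto split: if_splits)

section \<open>Leading words\<close>

text \<open>
  Words are compared by length first and then lexicographically. Looking at the length first makes all
  contractions smaller than all shuffles.
\<close>

definition leading :: "('a::linorder list \<Rightarrow>\<^sub>0 int) \<Rightarrow> 'a list \<Rightarrow> bool" where
  "leading f w \<longleftrightarrow> Poly_Mapping.lookup f w = 1 \<and>
    (\<forall>u\<in>Poly_Mapping.keys f. length u < length w \<or> length u = length w \<and> u \<le> w)"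

lemma leading_single: "leading (Poly_Mapping.single w 1) w"
  by (simp add: leading_def)

lemma leading_prepend_letter: "leading f w \<Longrightarrow> leading (prepend_letter a f) (a # w)"
  by (auto simp: leading_def lookup_prepend_letter)

lemma leading_add:
  assumes "leading f w" "\<And>u. u \<in> Poly_Mapping.keys g \<Longrightarrow> length u < length w"
  shows "leading (f + g) w"
proof -
  have "Poly_Mapping.lookup g w = 0" using assms(2)[of w] by (auto simp: in_keys_iff)
  then show ?thesis using assms Poly_Mapping.keys_add[of f g]
    by (auto simp: leading_def lookup_add)
qed

lemma full_length_word_in_shuffles:
  "x \<in> Poly_Mapping.keys (word_mixable_shuffle lam u v) \<Longrightarrow> length x = length u + length v \<Longrightarrow> x \<in> shuffles u v"
proof (induction lam u v arbitrary: x rule: word_mixable_shuffle.induct)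
  case (3 lam a u b v)
  from keys_word_mixable_shuffle_Cons[OF 3(4)] show ?case
  proof (elim disjE exE conjE)
    fix y assume "x = (a + b) # y" "y \<in> Poly_Mapping.keys (word_mixable_shuffle lam u v)"
    then show ?thesis using length_word_mixable_shuffle[of y lam u v] 3(5) by simp
  qed (use 3 in auto)
qed auto

text \<open>
  Only one shuffle produces the concatenation: by \<open>Cons_shuffle_less_append\<close>, its letters have to be
  taken from the first word as long as there are any.
\<close>

lemma lookup_word_mixable_shuffle_append:
  fixes S T :: "'a::{linorder, ab_semigroup_add} list multiset"
  assumes "\<forall>v\<in>#S. lyndon v" "\<forall>v\<in>#T. lyndon v" "\<And>s t. s \<in># S \<Longrightarrow> t \<in># T \<Longrightarrow> t < s"
  shows "Poly_Mapping.lookup (word_mixable_shuffle lam (desc_concat S) (desc_concat T))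
    (desc_concat S @ desc_concat T) = 1"
  using assms
proof (induction "desc_concat S" arbitrary: S)
  case Nil
  from Nil(1)[symmetric] show ?case by simp
next
  case (Cons a s)
  note S = Cons.hyps(2)[symmetric]
  show ?case
  proof (cases "desc_concat T")
    case Nil
    then show ?thesis by simp
  next
    case T: (Cons b t)
    obtain Y S' where Y: "\<forall>y\<in>#Y. lyndon y" "lyndon (a # desc_concat Y)" 
      "S = add_mset (a # desc_concat Y) S'" "s = desc_concat (Y + S')"
      using desc_concat_Cons_split[OF Cons.prems(1) S] by metis
    have 1: "Poly_Mapping.lookup (word_mixable_shuffle lam s (desc_concat T)) (s @ desc_concat T) = 1"
      unfolding Y(4)
    proof (rule Cons.hyps)
      show "\<forall>v\<in>#Y + S'. lyndon v" using Y Cons.prems by auto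
      fix x y assume "x \<in># Y + S'" "y \<in># T"
      then show "y < x"
        using Cons.prems(3)[of "a # desc_concat Y" y] Cons.prems(3)[of x y] Y
          lyndon_Cons_less_factors[OF Y(2,1), of x] by auto
    qed (use Y Cons.prems in auto)
    have 2: "Poly_Mapping.lookup (word_mixable_shuffle lam (a # s) t) (s @ b # t) = 0" if "a = b"
    proof (rule ccontr)
      assume "Poly_Mapping.lookup (word_mixable_shuffle lam (a # s) t) (s @ b # t) \<noteq> 0"
      then have "s @ b # t \<in> shuffles (desc_concat S) t"
        using full_length_word_in_shuffles[of "s @ b # t" lam "a # s" t] S by (simp add: in_keys_iff)
      from Cons_shuffle_less_append[OF Cons.prems _ T this] Y(3) S T that show False by simp
    qed
    have 3: "Poly_Mapping.lookup (word_mixable_shuffle lam s t) (s @ b # t) = 0"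
      using length_word_mixable_shuffle[of "s @ b # t" lam s t] by (auto simp: in_keys_iff)
    show ?thesis
      using 1 2 3 unfolding S T by (auto simp: lookup_add lookup_prepend_letter)
  qed
qed

text \<open>
  Replacing words of \<open>f\<close> and \<open>g\<close> by the leading ones can only increase their shuffles, so the largest word
  of the product comes from the two leading words alone.
\<close>

lemma leading_mixable_shuffle:
  fixes S T :: "'a::{linorder, ab_semigroup_add} list multiset"
  assumes S: "\<forall>v\<in>#S. lyndon v" and T: "\<forall>v\<in>#T. lyndon v" 
    and ST: "\<And>s t. s \<in># S \<Longrightarrow> t \<in># T \<Longrightarrow> t < s"
    and f: "leading f (desc_concat S)" and g: "leading g (desc_concat T)"
  shows "leading (mixable_shuffle lam f g) (desc_concat S @ desc_concat T)"
proof -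
  let ?s = "desc_concat S" and ?t = "desc_concat T"
  have cat: "desc_concat (S + T) = ?s @ ?t"
    by (rule desc_concat_union) (use ST in fastforce)
  have bound: "length x < length (?s @ ?t) \<or> length x = length (?s @ ?t) \<and> x \<le> ?s @ ?t \<and> (x = ?s @ ?t \<longrightarrow> u = ?s \<and> v = ?t)"
    if u: "u \<in> Poly_Mapping.keys f" and v: "v \<in> Poly_Mapping.keys g" and x: "x \<in> Poly_Mapping.keys (word_mixable_shuffle lam u v)" for u v x
  proof -
    have u': "length u < length ?s \<or> length u = length ?s \<and> u \<le> ?s" using f u by (auto simp: leading_def)
    have v': "length v < length ?t \<or> length v = length ?t \<and> v \<le> ?t" using g v by (auto simp: leading_def)
    show ?thesis
    proof (cases "length x < length (?s @ ?t)")
      case False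
      then have l: "length u = length ?s" "length v = length ?t" "length x = length u + length v" "u \<le> ?s" "v \<le> ?t"
        using u' v' length_word_mixable_shuffle[OF x] by auto
      obtain x' where x': "x' \<in> shuffles ?s ?t" "x \<le> x'" "x = x' \<longrightarrow> u = ?s \<and> v = ?t"
        using shuffle_mono[OF full_length_word_in_shuffles[OF x l(3)], of ?s ?t] l by auto
      moreover have "x' \<le> ?s @ ?t" using shuffle_le_desc_concat[OF S T x'(1)] cat by simp
      ultimately show ?thesis using l by auto
    qed simp
  qed
  have "Poly_Mapping.lookup (mixable_shuffle lam f g) (?s @ ?t) =
    (\<Sum>u\<in>Poly_Mapping.keys f. \<Sum>v\<in>Poly_Mapping.keys g. if v = ?t then (if u = ?s then 1 else 0) else 0)"
    unfolding lookup_mixable_shuffle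
  proof (intro sum.cong refl)
    fix u v assume uv: "u \<in> Poly_Mapping.keys f" "v \<in> Poly_Mapping.keys g"
    show "Poly_Mapping.lookup f u * Poly_Mapping.lookup g v * 
      Poly_Mapping.lookup (word_mixable_shuffle lam u v) (?s @ ?t) = (if v = ?t then if u = ?s then 1 else 0 else 0)"
    proof (cases "u = ?s \<and> v = ?t")
      case True
      then show ?thesis using f g lookup_word_mixable_shuffle_append[OF S T ST, of lam]
        by (simp add: leading_def)
    next
      case False
      then have "?s @ ?t \<notin> Poly_Mapping.keys (word_mixable_shuffle lam u v)"
        using bound[OF uv, of "?s @ ?t"] by auto
      then show ?thesis using False by (auto simp: in_keys_iff)
    qed
  qed
  also have "\<dots> = 1"
    using f g by (auto simp: leading_def in_keys_iff)
  finally show ?thesis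
    using bound keys_mixable_shuffle[of lam f g] unfolding leading_def by fastforce
qed

lemma desc_concat_replicate_mset: "desc_concat (replicate_mset n v) = concat (replicate n v)"
proof (induction n)
  case (Suc n)
  have "desc_concat ({#v#} + replicate_mset n v) = desc_concat {#v#} @ desc_concat (replicate_mset n v)"
    by (rule desc_concat_union) (auto split: if_splits)
  then show ?case using Suc by simp
qed simp

text \<open>
  In the recursion only the summand with \<open>j = 0\<close> reaches the full length \<open>n * length v\<close>. There the tail
  of \<open>v\<close> is multiplied by the elementary symmetric function of degree \<open>n - 1\<close>; the factors of the tail
  exceed \<open>v\<close>, so the leading word is the concatenation.
\<close>

lemma leading_elem_sym:
  fixes v :: "'b::linorder multiset list"
  assumes "lyndon v"
  shows "leading (elem_sym n v) (desc_concat (replicate_mset n v))"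
proof (induction n)
  case 0
  show ?case by (simp add: leading_single)
next
  case (Suc n)
  obtain a w where v: "v = a # w" using assms lyndon_nonempty by (cases v) auto
  obtain W where W: "\<forall>y\<in>#W. lyndon y" "desc_concat W = w" using lyndon_factorization_exists by blast
  define c where "c j = prepend_letter (repeat_mset (Suc j) a)
     (mixable_shuffle 1 (elem_sym (Suc j) w) (elem_sym (n - j) v))" for j
  have "elem_sym (Suc n) v = (\<Sum>j=0..n. c j)"
    by (simp add: v c_def)
  also have "\<dots> = c 0 + (\<Sum>j=Suc 0..n. c j)" by (rule sum.atLeast_Suc_atMost) simp
  finally have split: "elem_sym (Suc n) v = c 0 + (\<Sum>j=Suc 0..n. c j)" .
  have "leading (mixable_shuffle 1 (elem_sym (Suc 0) w) (elem_sym n v))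
    (desc_concat W @ desc_concat (replicate_mset n v))"
  proof (rule leading_mixable_shuffle)
    show "leading (elem_sym (Suc 0) w) (desc_concat W)" by (simp add: elem_sym_1 W leading_single)
    show "t < s" if "s \<in># W" "t \<in># replicate_mset n v" for s t
      using that lyndon_Cons_less_factors[of a W s] W assms v by (auto split: if_splits)
  qed (use W Suc assms in \<open>auto split: if_splits\<close>)
  then have "leading (c 0) (a # (w @ desc_concat (replicate_mset n v)))"
    unfolding c_def using W by (simp add: leading_prepend_letter)
  also have "a # (w @ desc_concat (replicate_mset n v)) = desc_concat (replicate_mset (Suc n) v)"
    by (simp add: desc_concat_replicate_mset v del: replicate_mset_Suc)
  finally have c0: "leading (c 0) (desc_concat (replicate_mset (Suc n) v))" .
  show ?case
    unfolding split
  proof (rule leading_add[OF c0])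
    fix x assume x: "x \<in> Poly_Mapping.keys (\<Sum>j=Suc 0..n. c j)"
    obtain j u u' y where j: "j \<le> n" "j > 0" "x = repeat_mset (Suc j) a # y"
      "u \<in> Poly_Mapping.keys (elem_sym (Suc j) w)" "u' \<in> Poly_Mapping.keys (elem_sym (n - j) v)"
      "y \<in> Poly_Mapping.keys (word_mixable_shuffle (1 :: int) u u')"
      using keys_sum_prepend_mixable_shuffle[OF x[unfolded c_def]]
      unfolding atLeastAtMost_iff Suc_le_eq by blast
    have "length x \<le> Suc (Suc j * length w + (n - j) * length v)"
      using j length_word_mixable_shuffle[OF j(6)] length_elem_sym[OF j(4)] length_elem_sym[OF j(5)] by simp
    also have "\<dots> < Suc j * length v + (n - j) * length v" using j v by simp
    also have "\<dots> = Suc n * length v" by (rule Suc_mult_plus_diff_mult[OF j(1)])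
    also have "\<dots> = length (desc_concat (replicate_mset (Suc n) v))"
      by (simp add: desc_concat_replicate_mset length_concat sum_list_replicate del: replicate_mset_Suc)
    finally show "length x < length (desc_concat (replicate_mset (Suc n) v))" .
  qed
qed

section \<open>Scaling and primitive words\<close>

abbreviation scale_word :: "nat \<Rightarrow> 'b multiset list \<Rightarrow> 'b multiset list" where
  "scale_word n \<equiv> map (repeat_mset n)"

text \<open>
  Invariance under scaling is the reason for using the multiset order on the letters: it makes the
  Lyndon property invariant as well.
\<close>

lemma repeat_mset_less_iff:
  fixes a b :: "'b::linorder multiset"
  assumes "n > 0"
  shows "repeat_mset n a < repeat_mset n b \<longleftrightarrow> a < b"
proof -
  have "multp (<) (repeat_mset n a) (repeat_mset n b) \<longleftrightarrow> multp (<) a b"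
    using assms by (simp add: multp_eq_multp\<^sub>H\<^sub>O)
  then show ?thesis by (simp add: less_multiset_def)
qed

lemma scale_word_less_iff:
  fixes u v :: "'b::linorder multiset list"
  assumes "n > 0"
  shows "scale_word n u < scale_word n v \<longleftrightarrow> u < v"
proof (induction u arbitrary: v)
  case Nil
  then show ?case by (cases v) auto
next
  case (Cons a u)
  have "repeat_mset n a = repeat_mset n b \<longleftrightarrow> a = b" for b
    using assms repeat_mset_less_iff[OF assms] by (metis less_irrefl neqE)
  then show ?case using Cons repeat_mset_less_iff[OF assms] by (cases v) auto
qed

lemma lyndon_scale_word_iff:
  fixes w :: "'b::linorder multiset list"
  assumes "n > 0"
  shows "lyndon (scale_word n w) \<longleftrightarrow> lyndon w"
proof
  assume L: "lyndon (scale_word n w)"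
  show "lyndon w"
    unfolding lyndon_def
  proof (intro conjI allI impI)
    show "w \<noteq> []" using lyndon_nonempty[OF L] by simp
    fix u v assume "w = u @ v" "u \<noteq> []" "v \<noteq> []"
    then have "scale_word n w < scale_word n v"
      using lyndon_less_suffix[of "scale_word n u" "scale_word n v"] L by simp
    then show "w < v" by (simp add: scale_word_less_iff assms)
  qed
next
  assume L: "lyndon w"
  show "lyndon (scale_word n w)"
    unfolding lyndon_def
  proof (intro conjI allI impI)
    show "scale_word n w \<noteq> []" using lyndon_nonempty[OF L] by simp
    fix u v assume "scale_word n w = u @ v" "u \<noteq> []" "v \<noteq> []"
    then obtain u' v' where "w = u' @ v'" "u = scale_word n u'" "v = scale_word n v'"
      by (auto simp: map_eq_append_conv)
    with \<open>u \<noteq> []\<close> \<open>v \<noteq> []\<close> have "w < v'"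
      using lyndon_less_suffix[of u' v'] L by simp
    then show "scale_word n w < v"
      using \<open>v = scale_word n v'\<close> by (simp add: scale_word_less_iff assms)
  qed
qed

lemma qsym_monomials_scale_word:
  "qsym_monomials m (scale_word n w) = map (\<lambda>y. y ^ n) (qsym_monomials m w)"
proof (induction m w rule: qsym_monomials.induct)
  case (3 m a w)
  then show ?case
    by (simp add: o_def power_mult_distrib var_repeat_mset)
qed auto

text \<open>
  Scaling a word raises its monomials to the \<open>n\<close>-th power.
\<close>

lemma realise_elem_sym_scale_word:
  assumes "n > 0"
  shows "realise 1 id (elem_sym r (scale_word n w)) \<in> ring_closure (range (\<lambda>k. realise 1 id (elem_sym k w)))"
  by (rule esym_power_in_ring_closure[OF assms, where ys = "\<lambda>m. qsym_monomials m w" and r = r])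
     (simp_all add: realise_elem_sym qsym_monomials_scale_word)

text \<open>
  For a word with a nonempty letter, this is the largest \<open>n\<close> such that all letters are \<open>n\<close>-th powers.
\<close>

definition word_gcd :: "'b multiset list \<Rightarrow> nat" where
  "word_gcd w = Gcd (\<Union>a\<in>set w. range (count a))"

lemma word_gcd_scale_word: "word_gcd (scale_word n w) = n * word_gcd w"
proof -
  have "range (count (repeat_mset n a)) = (*) n ` range (count a)" for a :: "'a multiset"
    by auto
  then have "(\<Union>a\<in>set (scale_word n w). range (count a)) = (*) n ` (\<Union>a\<in>set w. range (count a))"
    by (simp add: image_UN)
  then show ?thesis by (simp add: word_gcd_def Gcd_mult)
qed

lemma word_gcd_eq_0_iff: "word_gcd w = 0 \<longleftrightarrow> set w \<subseteq> {{#}}"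
  by (auto simp: word_gcd_def multiset_eq_iff subset_iff)

lemma ex_repeat_mset:
  assumes "\<And>x. n dvd count a x" "n > 0"
  shows "\<exists>b. a = repeat_mset n b"
proof -
  have "finite {x. 0 < count a x div n}"
    by (rule finite_subset[of _ "set_mset a"]) (auto intro: ccontr simp: not_in_iff)
  then have "a = repeat_mset n (Abs_multiset (\<lambda>x. count a x div n))"
    using assms by (intro multiset_eqI) (simp add: count_Abs_multiset)
  then show ?thesis by blast
qed

definition primitive_root :: "'b multiset list \<Rightarrow> 'b multiset list" where
  "primitive_root w = (SOME u. w = scale_word (word_gcd w) u)"

lemma scale_word_primitive_root:
  assumes "word_gcd w > 0"
  shows "scale_word (word_gcd w) (primitive_root w) = w"
proof -
  have "\<exists>b. a = repeat_mset (word_gcd w) b" if "a \<in> set w" for a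
    by (rule ex_repeat_mset) (use that assms in \<open>auto simp: word_gcd_def intro: Gcd_dvd\<close>)
  then have "\<exists>u. w = scale_word (word_gcd w) u"
    by (metis ex_map_conv)
  then show ?thesis
    unfolding primitive_root_def by (metis (mono_tags, lifting) someI_ex)
qed

lemma word_gcd_primitive_root:
  assumes "word_gcd w > 0"
  shows "word_gcd (primitive_root w) = 1"
proof -
  have "word_gcd w * 1 = word_gcd w * word_gcd (primitive_root w)"
    using word_gcd_scale_word[of "word_gcd w" "primitive_root w"]
    by (simp only: scale_word_primitive_root[OF assms] mult_1_right)
  then show ?thesis using assms by (simp only: mult_cancel1) auto
qed

lemma inj_scale_word:
  assumes "n > 0"
  shows "inj (scale_word n)"
proof -
  have "inj (repeat_mset n)" using assms by (intro injI) (simp add: repeat_mset_cancel1)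
  then show ?thesis by simp
qed

lemma primitive_root_scale_word:
  assumes "word_gcd u = 1" "n > 0"
  shows "word_gcd (scale_word n u) = n" "primitive_root (scale_word n u) = u"
proof -
  show 1: "word_gcd (scale_word n u) = n" using assms by (simp add: word_gcd_scale_word)
  show "primitive_root (scale_word n u) = u"
    using scale_word_primitive_root[of "scale_word n u", unfolded 1, OF assms(2)]
    by (rule injD[OF inj_scale_word[OF assms(2)]])
qed

section \<open>Generators\<close>

abbreviation words :: "'b set \<Rightarrow> 'b multiset list set" where
  "words X \<equiv> lists (free_abelian_semigroup X)"

definition lyndon_words :: "'b::linorder set \<Rightarrow> 'b multiset list set" where
  "lyndon_words X = {w \<in> words X. lyndon w}"

text \<open>
  A Lyndon word \<open>w\<close> is \<open>n\<close> times a unique primitive word \<open>u\<close>. Its generator is not \<open>w\<close> itself, which would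
  only work over the rationals, but the \<open>n\<close>-th elementary symmetric function of \<open>u\<close>. It has the same
  content as \<open>w\<close>.
\<close>

definition generator :: "'b multiset list \<Rightarrow> 'b multiset list \<Rightarrow>\<^sub>0 int" where
  "generator w = elem_sym (word_gcd w) (primitive_root w)"

lemma free_abelian_semigroup_add:
  "a \<in> free_abelian_semigroup X \<Longrightarrow> b \<in> free_abelian_semigroup X \<Longrightarrow> a + b \<in> free_abelian_semigroup X"
  by (auto simp: free_abelian_semigroup_def)

lemma keys_elem_sym_words: "w \<in> words X \<Longrightarrow> Poly_Mapping.keys (elem_sym n w) \<subseteq> words X"
  by (rule keys_elem_sym_lists[OF free_abelian_semigroup_add])

lemma keys_word_mixable_shuffle_words:
  "u \<in> words X \<Longrightarrow> v \<in> words X \<Longrightarrow> Poly_Mapping.keys (word_mixable_shuffle lam u v) \<subseteq> words X"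
  by (rule keys_word_mixable_shuffle_lists[OF free_abelian_semigroup_add])

lemma empty_notin_words: "w \<in> words X \<Longrightarrow> {#} \<notin> set w"
  by (auto simp: free_abelian_semigroup_def)

lemma scale_word_in_words_iff: "n > 0 \<Longrightarrow> scale_word n w \<in> words X \<longleftrightarrow> w \<in> words X"
proof -
  assume "n > 0"
  then have "set_mset (repeat_mset n a) = set_mset a" for a :: "'a multiset"
    by (auto simp flip: count_greater_zero_iff)
  then have "repeat_mset n a \<in> free_abelian_semigroup X \<longleftrightarrow> a \<in> free_abelian_semigroup X" for a
    unfolding free_abelian_semigroup_def mem_Collect_eq by (metis set_mset_eq_empty_iff)
  then show ?thesis by auto
qed

lemma word_gcd_pos:
  assumes "w \<in> words X" "w \<noteq> []"
  shows "word_gcd w > 0"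
proof -
  obtain a where "a \<in> set w" using assms by (cases w) auto
  then have "\<not> set w \<subseteq> {{#}}" using empty_notin_words[OF assms(1)] by auto
  then show ?thesis using word_gcd_eq_0_iff[of w] by auto
qed

lemma lyndon_words_word_gcd_pos: "w \<in> lyndon_words X \<Longrightarrow> word_gcd w > 0"
  by (auto simp: lyndon_words_def dest: lyndon_nonempty intro!: word_gcd_pos simp del: in_lists_conv_set)

lemma primitive_root_in_lyndon_words:
  assumes "w \<in> lyndon_words X"
  shows "primitive_root w \<in> lyndon_words X"
proof -
  have g: "word_gcd w > 0" by (rule lyndon_words_word_gcd_pos[OF assms])
  show ?thesis
    using assms lyndon_scale_word_iff[OF g, of "primitive_root w"]
      scale_word_in_words_iff[OF g, of "primitive_root w" X]
    unfolding scale_word_primitive_root[OF g] lyndon_words_def by blast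
qed

lemma keys_generator:
  assumes "w \<in> lyndon_words X"
  shows "Poly_Mapping.keys (generator w) \<subseteq> {u \<in> words X. sum_list u = sum_list w}"
proof -
  have g: "word_gcd w > 0" by (rule lyndon_words_word_gcd_pos[OF assms])
  have "sum_list (scale_word n u) = repeat_mset n (sum_list u)" for n and u :: "'a multiset list"
    by (induction u) (auto simp: multiset_eq_iff algebra_simps)
  from this[of "word_gcd w" "primitive_root w"]
  have "sum_list w = repeat_mset (word_gcd w) (sum_list (primitive_root w))"
    by (simp add: scale_word_primitive_root[OF g])
  moreover have "Poly_Mapping.keys (generator w) \<subseteq> words X"
    unfolding generator_def using primitive_root_in_lyndon_words[OF assms] 
    by (intro keys_elem_sym_words) (simp add: lyndon_words_def)
  ultimately show ?thesis
    using sum_list_elem_sym[of _ "word_gcd w" "primitive_root w"] by (auto simp: generator_def simp del: in_lists_conv_set)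
qed

definition generated :: "'b::linorder set \<Rightarrow> (nat \<Rightarrow> (nat \<Rightarrow>\<^sub>0 'b multiset) \<Rightarrow>\<^sub>0 int) set" where
  "generated X = ring_closure ((\<lambda>w. realise 1 id (generator w)) ` lyndon_words X)"

text \<open>
  For a primitive word the elementary symmetric functions are generators. The general case consists of
  symmetric functions of powers of monomials of the primitive root.
\<close>

lemma elem_sym_in_generated:
  assumes "w \<in> lyndon_words X"
  shows "realise 1 id (elem_sym r w) \<in> generated X"
proof -
  have g: "word_gcd w > 0" by (rule lyndon_words_word_gcd_pos[OF assms])
  let ?u = "primitive_root w"
  have u: "?u \<in> lyndon_words X" "word_gcd ?u = 1"
    using primitive_root_in_lyndon_words[OF assms] word_gcd_primitive_root[OF g] by auto
  have "realise 1 id (elem_sym k ?u) \<in> generated X" for k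
  proof (cases "k = 0")
    case True
    then show ?thesis by (simp add: generated_def ring_closure.one)
  next
    case False
    then have "scale_word k ?u \<in> lyndon_words X"
      using u scale_word_in_words_iff[of k ?u X] lyndon_scale_word_iff[of k ?u]
      by (simp add: lyndon_words_def)
    moreover have "generator (scale_word k ?u) = elem_sym k ?u"
      using primitive_root_scale_word[OF u(2), of k] False by (simp add: generator_def)
    ultimately show ?thesis unfolding generated_def by (metis image_eqI ring_closure.gen)
  qed
  then have "ring_closure (range (\<lambda>k. realise 1 id (elem_sym k ?u))) \<subseteq> generated X"
    unfolding generated_def by (intro ring_closure_subset) auto
  then show ?thesis
    using realise_elem_sym_scale_word[OF g, of r ?u] scale_word_primitive_root[OF g] by auto
qed

lemma length_le_size_content:
  assumes "w \<in> words X"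
  shows "length w \<le> size (sum_list w)"
  using empty_notin_words[OF assms]
proof (induction w)
  case (Cons a w)
  then have "1 \<le> size a" by (simp add: Suc_le_eq nonempty_has_size[symmetric])
  then show ?case using Cons by simp
qed simp

lemma finite_submultisets: "finite {a. a \<subseteq># M}"
proof (induction M)
  case (add x M)
  have "{a. a \<subseteq># add_mset x M} \<subseteq> {a. a \<subseteq># M} \<union> add_mset x ` {a. a \<subseteq># M}"
  proof
    fix a assume a: "a \<in> {a. a \<subseteq># add_mset x M}"
    show "a \<in> {a. a \<subseteq># M} \<union> add_mset x ` {a. a \<subseteq># M}"
    proof (cases "x \<in># a")
      case True
      then have "a = add_mset x (a - {#x#})" by simp
      moreover from this a have "a - {#x#} \<subseteq># M" by (metis mem_Collect_eq mset_subset_eq_add_mset_cancel)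
      ultimately show ?thesis by blast
    next
      case False
      have "count a y \<le> count M y" for y
        using a False mset_subset_eq_count[of a "add_mset x M" y] by (cases "x = y") (auto simp: not_in_iff)
      then show ?thesis by (simp add: subseteq_mset_def)
    qed
  qed
  then show ?case using add by (auto intro: finite_subset)
qed simp

lemma finite_words_of_content: "finite {w \<in> words X. sum_list w = M}"
proof (rule finite_subset)
  show "{w \<in> words X. sum_list w = M} \<subseteq> {w. set w \<subseteq> {a. a \<subseteq># M} \<and> length w \<le> size M}"
  proof
    fix w assume "w \<in> {w \<in> words X. sum_list w = M}"
    then have w: "w \<in> words X" "sum_list w = M" by blast+
    have "a \<subseteq># sum_list w" if "a \<in> set w" for a
      using that by (induction w) (auto intro: subset_mset.add_increasing subset_mset.add_increasing2)
    moreover have "length w \<le> size (sum_list w)" by (rule length_le_size_content[OF w(1)])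
    ultimately show "w \<in> {w. set w \<subseteq> {a. a \<subseteq># M} \<and> length w \<le> size M}"
      using w by auto
  qed
  show "finite {w. set w \<subseteq> {a. a \<subseteq># M} \<and> length w \<le> size M}"
    by (intro finite_lists_length_le finite_submultisets)
qed

lemma ex_length_lex_minimal:
  fixes B :: "'a::linorder list set"
  assumes "finite B" "B \<noteq> {}"
  obtains w where "w \<in> B" "\<And>u. u \<in> B \<Longrightarrow> length w < length u \<or> length w = length u \<and> w \<le> u"
proof -
  let ?B = "{u \<in> B. length u = Min (length ` B)}"
  have "Min (length ` B) \<in> length ` B" using assms by (intro Min_in) auto
  then have ne: "?B \<noteq> {}" by force
  have fin: "finite ?B" using assms by simp
  have w: "Min ?B \<in> ?B" by (rule Min_in[OF fin ne])
  show ?thesis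
  proof (rule that)
    show "Min ?B \<in> B" using w by simp
    fix u assume u: "u \<in> B"
    then have "Min (length ` B) \<le> length u" using assms by simp
    moreover have "Min ?B \<le> u" if "length u = Min (length ` B)"
      using u that fin by (intro Min_le) auto
    ultimately show "length (Min ?B) < length u \<or> length (Min ?B) = length u \<and> Min ?B \<le> u"
      using w by auto
  qed
qed

text \<open>
  Induction over the size of the content, and for fixed content over words by length and then
  lexicographically. Let \<open>v\<close> be the largest Lyndon factor of \<open>b\<close>, with multiplicity \<open>n\<close>, and \<open>t\<close> the product of
  the other factors. The element \<open>elem_sym n v\<close> times \<open>t\<close> lies in the subring, and its leading word is \<open>b\<close>
  with coefficient one; all other words in it are smaller.
\<close>

lemma word_in_generated:
  assumes "w \<in> words X"
  shows "qsym 1 id w \<in> generated X"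
  using assms
proof (induction "size (sum_list w)" arbitrary: w rule: less_induct)
  case less
  define W where "W = {u \<in> words X. sum_list u = sum_list w}"
  \<comment> \<open>\<open>W\<close> is finite, so a minimal counterexample exists.\<close>
  define B where "B = {u \<in> W. qsym 1 id u \<notin> generated X}"
  have finB: "finite B"
    by (rule finite_subset[OF _ finite_words_of_content[of X "sum_list w"]]) (auto simp: B_def W_def)
  have "B = {}"
  proof (rule ccontr)
    assume "B \<noteq> {}"
    from finB this obtain b where b: "b \<in> B" 
      "\<And>u. u \<in> B \<Longrightarrow> length b < length u \<or> length b = length u \<and> b \<le> u"
      by (rule ex_length_lex_minimal) blast
    have bW: "b \<in> words X" "sum_list b = sum_list w" using b by (auto simp: B_def W_def)
    have "b \<noteq> []"
    proof
      assume "b = []"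
      then have "qsym 1 id b = 1" by (simp add: fun_eq_iff)
      then show False using b by (simp add: B_def generated_def ring_closure.one)
    qed
    obtain Q where Q: "\<forall>v\<in>#Q. lyndon v" "desc_concat Q = b" using lyndon_factorization_exists by blast
    with \<open>b \<noteq> []\<close> have "Q \<noteq> {#}" by auto
    then obtain v where v: "v \<in># Q" "\<And>u. u \<in># Q \<Longrightarrow> u \<le> v" by (rule Max_mset) blast
    define n where "n = count Q v"
    define Q' where "Q' = filter_mset (\<lambda>u. u \<noteq> v) Q"
    define t where "t = desc_concat Q'"
    have Qsplit: "Q = replicate_mset n v + Q'"
      by (rule multiset_eqI) (simp add: n_def Q'_def)
    have "desc_concat Q = desc_concat (replicate_mset n v) @ t"
      unfolding t_def Qsplit by (rule desc_concat_union) (use v in \<open>auto simp: Q'_def split: if_splits\<close>)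
    then have bvt: "b = desc_concat (replicate_mset n v) @ t" using Q by simp
    have npos: "n > 0" using v by (simp add: n_def)
    have letters: "set v \<subseteq> set b" "set t \<subseteq> set b"
      using v Q by (auto simp: set_desc_concat t_def Q'_def simp flip: Q(2))
    have bX: "set b \<subseteq> free_abelian_semigroup X" using bW(1) by auto
    have lv: "lyndon v" using Q(1) v(1) by blast
    have vX: "v \<in> lyndon_words X"
      using letters(1) bX lv by (auto simp: lyndon_words_def)
    have tX: "t \<in> words X" using letters(2) bX by auto
    define f where "f = mixable_shuffle 1 (elem_sym n v) (Poly_Mapping.single t 1)"
    have lead: "leading f b"
      unfolding bvt f_def t_def
    proof (rule leading_mixable_shuffle)
      show "\<forall>x\<in>#replicate_mset n v. lyndon x" using lv by (auto split: if_splits)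
      show "\<forall>x\<in>#Q'. lyndon x" using Q(1) by (auto simp: Q'_def)
      fix x y assume "x \<in># replicate_mset n v" "y \<in># Q'"
      then have "x = v" "y \<in># Q" "y \<noteq> v" by (auto simp: Q'_def split: if_splits)
      then show "y < x" using v(2)[of y] by (metis order.not_eq_order_implies_strict)
    qed (use lv in \<open>simp_all add: leading_elem_sym leading_single\<close>)
    have content: "sum_list b = repeat_mset n (sum_list v) + sum_list t"
    proof -
      have "sum_list (concat (replicate n v)) = repeat_mset n (sum_list v)" by (induction n) auto
      then show ?thesis unfolding bvt by (simp add: desc_concat_replicate_mset)
    qed
    have keys: "Poly_Mapping.keys f \<subseteq> W"
    proof
      fix x assume "x \<in> Poly_Mapping.keys f"
      then obtain u where u: "u \<in> Poly_Mapping.keys (elem_sym n v)" 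
        and x: "x \<in> Poly_Mapping.keys (word_mixable_shuffle (1 :: int) u t)"
        using keys_mixable_shuffle[of 1 "elem_sym n v" "Poly_Mapping.single t 1"] unfolding f_def by auto
      have "u \<in> words X" using u keys_elem_sym_words[of v X n] vX
        unfolding lyndon_words_def by blast
      then have "x \<in> words X"
        using keys_word_mixable_shuffle_words[of u X t] tX x by blast
      moreover have "sum_list x = sum_list w"
        using sum_list_word_mixable_shuffle[OF x] sum_list_elem_sym[OF u] content bW by simp
      ultimately show "x \<in> W" by (simp only: W_def) simp
    qed
    have "qsym 1 id t \<in> generated X"
    proof (rule less.hyps)
      have "v \<noteq> []" using Q v lyndon_nonempty by blast
      moreover have "length v \<le> size (sum_list v)"
        by (rule length_le_size_content[of v X]) (use vX in \<open>simp add: lyndon_words_def\<close>)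
      ultimately have "size (repeat_mset n (sum_list v)) > 0" using npos
        by (cases v) auto
      then show "size (sum_list t) < size (sum_list w)" using content bW by simp
    qed (rule tX)
    then have f_gen: "realise 1 id f \<in> generated X"
      unfolding f_def realise_mixable_shuffle[of id, simplified] realise_single
      using elem_sym_in_generated[OF vX, of n] by (simp add: generated_def ring_closure.mult)
    have "b \<in> Poly_Mapping.keys f" using lead by (simp add: leading_def in_keys_iff)
    then have eq: "realise 1 id f = qsym 1 id b +
      (\<Sum>u\<in>Poly_Mapping.keys f - {b}. of_int (Poly_Mapping.lookup f u) * qsym 1 id u)"
      using lead by (simp add: realise_def lin_ext_def sum.remove leading_def)
    have smaller: "qsym 1 id u \<in> generated X" if u: "u \<in> Poly_Mapping.keys f - {b}" for u
    proof -
      have "u \<in> W" "u \<noteq> b" using u keys by blast+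
      moreover have "length u < length b \<or> length u = length b \<and> u \<le> b"
        using u lead by (auto simp: leading_def)
      ultimately have "u \<notin> B" using b(2)[of u] by force
      with \<open>u \<in> W\<close> show ?thesis by (simp add: B_def)
    qed
    have "(\<Sum>u\<in>Poly_Mapping.keys f - {b}. of_int (Poly_Mapping.lookup f u) * qsym 1 id u) \<in> generated X"
      unfolding generated_def
      by (intro ring_closure_sum ring_closure.mult ring_closure_of_int)
         (rule smaller[unfolded generated_def])
    with f_gen have "realise 1 id f -
        (\<Sum>u\<in>Poly_Mapping.keys f - {b}. of_int (Poly_Mapping.lookup f u) * qsym 1 id u) \<in> generated X"
      unfolding generated_def by (rule ring_closure.diff)
    then have "qsym 1 id b \<in> generated X" unfolding eq by (simp only: add_diff_cancel_right')
    then show False using b by (simp add: B_def)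
  qed
  then show ?case using less.prems by (auto simp: B_def W_def)
qed

section \<open>Independence by counting\<close>

text \<open>
  Over the rationals, a one-sided inverse of a square matrix is two-sided.
\<close>

lemma right_inverse_if_left_inverse:
  fixes c d :: "'i \<Rightarrow> 'i \<Rightarrow> int"
  assumes I: "finite I" and cd: "\<And>i k. i \<in> I \<Longrightarrow> k \<in> I \<Longrightarrow> (\<Sum>j\<in>I. c i j * d j k) = (if i = k then 1 else 0)"
    and ik: "i \<in> I" "k \<in> I"
  shows "(\<Sum>j\<in>I. d i j * c j k) = (if i = k then 1 else 0)"
proof -
  define n where "n = card I"
  obtain h where h: "bij_betw h {0..<n} I" using ex_bij_betw_nat_finite[OF I] n_def by blast
  have hI: "h x \<in> I" if "x < n" for x using h that by (auto simp: bij_betw_def)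
  have hinj: "h x = h y \<longleftrightarrow> x = y" if "x < n" "y < n" for x y
    using h that by (auto simp: bij_betw_def inj_on_def)
  define M :: "('i \<Rightarrow> 'i \<Rightarrow> int) \<Rightarrow> rat mat" where "M e = mat n n (\<lambda>(x, y). of_int (e (h x) (h y)))" for e
  have M: "M e \<in> carrier_mat n n" for e by (simp add: M_def)
  have prod: "(M e * M e') $$ (x, y) = of_int (\<Sum>j\<in>I. e (h x) j * e' j (h y))" if "x < n" "y < n" for e e' x y
  proof -
    have "(M e * M e') $$ (x, y) = (\<Sum>j\<in>{0..<n}. of_int (e (h x) (h j) * e' (h j) (h y)))"
      using that by (simp add: M_def scalar_prod_def)
    also have "\<dots> = of_int (\<Sum>j\<in>I. e (h x) j * e' j (h y))"
      unfolding of_int_sum by (rule sum.reindex_bij_betw[OF h])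
    finally show ?thesis .
  qed
  have "M c * M d = 1\<^sub>m n"
    by (rule eq_matI) (use M[of c] M[of d] in \<open>auto simp: prod cd hI hinj simp del: index_mult_mat(1)\<close>)
  then have dc: "M d * M c = 1\<^sub>m n" by (rule mat_mult_left_right_inverse[OF M M])
  obtain x y where xy: "x < n" "y < n" "i = h x" "k = h y"
    using ik h by (auto simp: bij_betw_def image_iff)
  have "of_int (\<Sum>j\<in>I. d i j * c j k) = (1\<^sub>m n :: rat mat) $$ (x, y)"
    using prod[OF xy(1,2), of d c] unfolding dc xy(3,4) by (rule sym)
  also have "\<dots> = of_int (if i = k then 1 else 0)"
    using xy hinj[OF xy(1,2)] by simp
  finally show ?thesis by (simp only: of_int_eq_iff)
qed

definition generator_prod :: "'b::linorder multiset list multiset \<Rightarrow> nat \<Rightarrow> (nat \<Rightarrow>\<^sub>0 'b multiset) \<Rightarrow>\<^sub>0 int" where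
  "generator_prod Q = (\<Prod>w\<in>#Q. realise 1 id (generator w))"

lemma generator_prod_empty [simp]: "generator_prod {#} = 1"
  by (simp add: generator_prod_def)

lemma generator_prod_union: "generator_prod (Q + Q') = generator_prod Q * generator_prod Q'"
  by (simp add: generator_prod_def)

lemma generated_eq_lin_ext:
  assumes "t \<in> generated X"
  shows "\<exists>p. (\<forall>Q\<in>Poly_Mapping.keys p. set_mset Q \<subseteq> lyndon_words X) \<and> lin_ext generator_prod p = t"
  using assms unfolding generated_def
proof (induction rule: ring_closure.induct)
  case (gen t)
  then obtain w where "w \<in> lyndon_words X" "t = realise 1 id (generator w)" by blast
  then show ?case
    by (intro exI[of _ "Poly_Mapping.single {#w#} 1"]) (simp add: generator_prod_def)
next
  case one
  have "lin_ext generator_prod (Poly_Mapping.single {#} 1) = 1"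
    by (simp only: lin_ext_single generator_prod_empty of_int_1 mult_1)
  moreover have "\<forall>Q\<in>Poly_Mapping.keys (Poly_Mapping.single {#} (1 :: int)). set_mset Q \<subseteq> lyndon_words X"
    by (simp only: keys_single) auto
  ultimately show ?case by blast
next
  case (diff s t)
  then obtain p q where "\<forall>Q\<in>Poly_Mapping.keys p. set_mset Q \<subseteq> lyndon_words X" "lin_ext generator_prod p = s"
    "\<forall>Q\<in>Poly_Mapping.keys q. set_mset Q \<subseteq> lyndon_words X" "lin_ext generator_prod q = t" by blast
  then show ?case
    using keys_diff[of p q] by (intro exI[of _ "p - q"]) (auto simp: lin_ext_diff)
next
  case (mult s t)
  then obtain p q where pq: "\<forall>Q\<in>Poly_Mapping.keys p. set_mset Q \<subseteq> lyndon_words X" "lin_ext generator_prod p = s"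
    "\<forall>Q\<in>Poly_Mapping.keys q. set_mset Q \<subseteq> lyndon_words X" "lin_ext generator_prod q = t" by blast
  have "lin_ext generator_prod (p * q) = s * t"
    using pq by (simp add: lin_ext_mult generator_prod_union)
  moreover have "\<forall>Q\<in>Poly_Mapping.keys (p * q). set_mset Q \<subseteq> lyndon_words X"
    using pq keys_mult[of p q] by fastforce
  ultimately show ?case by blast
qed

lemma sum_list_desc_concat: "sum_list (desc_concat Q) = (\<Sum>v\<in>#Q. sum_list v)"
  for Q :: "'a::{linorder, comm_monoid_add} list multiset"
proof -
  have "sum_list (concat xs) = (\<Sum>v\<in>#mset xs. sum_list v)" for xs :: "'a list list"
    by (induction xs) auto
  from this[of "rev (sorted_list_of_multiset Q)"] show ?thesis by (simp add: desc_concat_def)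
qed

lemma generator_prod_homogeneous:
  assumes "set_mset Q \<subseteq> lyndon_words X"
  shows "\<exists>f. Poly_Mapping.keys f \<subseteq> {u \<in> words X. sum_list u = (\<Sum>v\<in>#Q. sum_list v)} \<and> 
    generator_prod Q = realise 1 id f"
  using assms
proof (induction Q)
  case empty
  show ?case by (intro exI[of _ "Poly_Mapping.single [] 1"]) simp
next
  case (add v Q)
  then have "set_mset Q \<subseteq> lyndon_words X" by simp
  from add.IH[OF this] obtain f
    where f: "Poly_Mapping.keys f \<subseteq> {u \<in> words X. sum_list u = (\<Sum>v\<in>#Q. sum_list v)}"
      "generator_prod Q = realise 1 id f" by blast
  let ?f = "mixable_shuffle 1 (generator v) f"
  have v: "Poly_Mapping.keys (generator v) \<subseteq> {u \<in> words X. sum_list u = sum_list v}"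
    using add.prems by (intro keys_generator) simp
  have "x \<in> words X \<and> sum_list x = (\<Sum>v\<in>#add_mset v Q. sum_list v)" if x: "x \<in> Poly_Mapping.keys ?f" for x
  proof -
    obtain u u' where u: "u \<in> Poly_Mapping.keys (generator v)" "u' \<in> Poly_Mapping.keys f"
      "x \<in> Poly_Mapping.keys (word_mixable_shuffle (1 :: int) u u')"
      using subsetD[OF keys_mixable_shuffle x] by blast
    then have "u \<in> words X" "u' \<in> words X" "sum_list u = sum_list v" "sum_list u' = (\<Sum>v\<in>#Q. sum_list v)"
      using v f by blast+
    then show ?thesis
      using sum_list_word_mixable_shuffle[OF u(3)] keys_word_mixable_shuffle_words[of u X u' "1 :: int"] u(3)
      by (metis image_mset_add_mset subsetD sum_mset.insert)
  qed
  moreover have "generator_prod (add_mset v Q) = realise 1 id ?f"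
    using f by (simp add: generator_prod_def realise_mixable_shuffle)
  ultimately show ?case by blast
qed

lemma word_coeff_generator_prod_eq_0:
  assumes "set_mset Q \<subseteq> lyndon_words X" "u \<in> words X" "sum_list u \<noteq> (\<Sum>v\<in>#Q. sum_list v)"
  shows "word_coeff (generator_prod Q) u = 0"
proof -
  obtain f where f: "Poly_Mapping.keys f \<subseteq> {u \<in> words X. sum_list u = (\<Sum>v\<in>#Q. sum_list v)}"
    "generator_prod Q = realise 1 id f"
    using generator_prod_homogeneous[OF assms(1)] by blast
  have "word_coeff (generator_prod Q) u = Poly_Mapping.lookup f u"
    unfolding f(2) by (rule word_coeff_realise_id) (use empty_notin_words[OF assms(2)] in simp)
  also have "\<dots> = 0"
    using f(1) assms(3) by (metis (mono_tags, lifting) in_keys_iff mem_Collect_eq subsetD)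
  finally show ?thesis .
qed

definition lyndon_factors :: "'a::linorder list \<Rightarrow> 'a list multiset" where
  "lyndon_factors w = (SOME Q. (\<forall>v\<in>#Q. lyndon v) \<and> desc_concat Q = w)"

lemma lyndon_factors_correct: "\<forall>v\<in>#lyndon_factors w. lyndon v" "desc_concat (lyndon_factors w) = w"
  using someI_ex[OF lyndon_factorization_exists[of w]] unfolding lyndon_factors_def by auto

lemma lyndon_factors_desc_concat: "\<forall>v\<in>#Q. lyndon v \<Longrightarrow> lyndon_factors (desc_concat Q) = Q"
  by (rule lyndon_factorization_unique) (auto simp: lyndon_factors_correct)

lemma desc_concat_in_words_iff: "desc_concat Q \<in> words X \<longleftrightarrow> (\<forall>v\<in>#Q. v \<in> words X)"
  by (auto simp: set_desc_concat in_lists_conv_set)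

text \<open>
  In the component of a fixed content, the products of generators are indexed by the words of that
  content, through the Lyndon factorization.
\<close>

lemma word_coeff_lin_ext_generator_prod:
  fixes X :: "'b::linorder set"
  assumes p: "\<forall>Q\<in>Poly_Mapping.keys p. set_mset Q \<subseteq> lyndon_words X" and u: "u \<in> words X"
  shows "word_coeff (lin_ext generator_prod p) u =
    (\<Sum>w | w \<in> words X \<and> sum_list w = sum_list u.
      Poly_Mapping.lookup p (lyndon_factors w) * word_coeff (generator_prod (lyndon_factors w)) u)"
proof -
  let ?W = "{w \<in> words X. sum_list w = sum_list u}"
  let ?t = "\<lambda>Q. Poly_Mapping.lookup p Q * word_coeff (generator_prod Q) u"
  have inj: "inj_on lyndon_factors ?W" by (rule inj_on_inverseI[of _ desc_concat]) (rule lyndon_factors_correct)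
  have fin: "finite ?W" by (rule finite_words_of_content)
  have "word_coeff (lin_ext generator_prod p) u = (\<Sum>Q\<in>Poly_Mapping.keys p. ?t Q)"
    by (simp add: lin_ext_def word_coeff_sum word_coeff_of_int_mult)
  also have "\<dots> = (\<Sum>Q\<in>Poly_Mapping.keys p \<union> lyndon_factors ` ?W. ?t Q)"
    by (rule sum.mono_neutral_left) (use fin in \<open>auto simp: in_keys_iff\<close>)
  also have "\<dots> = (\<Sum>Q\<in>lyndon_factors ` ?W. ?t Q)"
  proof (rule sum.mono_neutral_right)
    show "\<forall>Q\<in>Poly_Mapping.keys p \<union> lyndon_factors ` ?W - lyndon_factors ` ?W. ?t Q = 0"
    proof
      fix Q assume Q: "Q \<in> Poly_Mapping.keys p \<union> lyndon_factors ` ?W - lyndon_factors ` ?W"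
      then have L: "set_mset Q \<subseteq> lyndon_words X" using p by auto
      then have "\<forall>v\<in>#Q. lyndon v" "\<forall>v\<in>#Q. v \<in> words X" unfolding lyndon_words_def by blast+
      then have "Q = lyndon_factors (desc_concat Q)" "desc_concat Q \<in> words X"
        by (simp_all only: lyndon_factors_desc_concat desc_concat_in_words_iff)
      then have "sum_list (desc_concat Q) \<noteq> sum_list u" using Q by blast
      then have "word_coeff (generator_prod Q) u = 0"
        by (intro word_coeff_generator_prod_eq_0[OF L u]) (metis sum_list_desc_concat)
      then show "?t Q = 0" by simp
    qed
  qed (use fin in auto)
  also have "\<dots> = (\<Sum>w\<in>?W. ?t (lyndon_factors w))" by (simp add: sum.reindex[OF inj])
  finally show ?thesis .
qed

text \<open>
  Fix a content. There are finitely many words with it, and equally many products of generators. Let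
  \<open>d\<close> expand the products in words and \<open>c\<close> express words through products. The matrix product of
  \<open>c\<close> and \<open>d\<close> is the identity. As both are square, that of \<open>d\<close> and \<open>c\<close> is the identity too, so the
  products of generators are independent.
\<close>

lemma generator_prods_independent:
  fixes X :: "'b::linorder set"
  assumes p: "\<forall>Q\<in>Poly_Mapping.keys p. set_mset Q \<subseteq> lyndon_words X" and zero: "lin_ext generator_prod p = 0"
  shows "p = 0"
proof (rule ccontr)
  assume "p \<noteq> 0"
  then obtain Q where Q: "Q \<in> Poly_Mapping.keys p" using keys_eq_empty[of p] by blast
  define w where "w = desc_concat Q"
  have L: "\<forall>v\<in>#Q. lyndon v" "\<forall>v\<in>#Q. v \<in> words X" using p Q unfolding lyndon_words_def by blast+
  define W where "W = {u \<in> words X. sum_list u = sum_list w}"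
  have w: "w \<in> W" "lyndon_factors w = Q"
    using L desc_concat_in_words_iff[of Q X] lyndon_factors_desc_concat[of Q] by (simp_all add: w_def W_def)
  have finW: "finite W" unfolding W_def by (rule finite_words_of_content)
  have "\<exists>q. (\<forall>Q\<in>Poly_Mapping.keys q. set_mset Q \<subseteq> lyndon_words X) \<and> lin_ext generator_prod q = qsym 1 id u"
    if "u \<in> W" for u
    using that by (intro generated_eq_lin_ext word_in_generated) (simp add: W_def)
  then obtain q where q: "\<And>u. u \<in> W \<Longrightarrow> \<forall>Q\<in>Poly_Mapping.keys (q u). set_mset Q \<subseteq> lyndon_words X"
    "\<And>u. u \<in> W \<Longrightarrow> lin_ext generator_prod (q u) = qsym 1 id u" by metis
  define c where "c u v = Poly_Mapping.lookup (q u) (lyndon_factors v)" for u v :: "'b multiset list"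
  define d where "d v u = word_coeff (generator_prod (lyndon_factors v)) u" for v u :: "'b multiset list"
  have W_eq: "{x. x \<in> words X \<and> sum_list x = sum_list u} = W" if "u \<in> W" for u
    using that unfolding W_def by auto
  have uX: "u \<in> words X" if "u \<in> W" for u using that unfolding W_def by blast
  have cd: "(\<Sum>v\<in>W. c i v * d v k) = (if i = k then 1 else 0)" if ik: "i \<in> W" "k \<in> W" for i k
  proof -
    have "(\<Sum>v\<in>W. c i v * d v k) = word_coeff (lin_ext generator_prod (q i)) k"
      using word_coeff_lin_ext_generator_prod[OF q(1)[OF ik(1)] uX[OF ik(2)]]
      unfolding W_eq[OF ik(2)] c_def d_def by simp
    also have "\<dots> = word_coeff (realise 1 id (Poly_Mapping.single i 1)) k"
      using q(2)[OF ik(1)] by (simp add: realise_single)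
    also have "\<dots> = (if i = k then 1 else 0)"
      using empty_notin_words[OF uX[OF ik(2)]] by (simp add: word_coeff_realise_id lookup_single when_def)
    finally show ?thesis .
  qed
  have dc: "(\<Sum>u\<in>W. d i u * c u k) = (if i = k then 1 else 0)" if "i \<in> W" "k \<in> W" for i k
    using right_inverse_if_left_inverse[OF finW cd that] by simp
  have "0 = (\<Sum>v\<in>W. Poly_Mapping.lookup p (lyndon_factors v) * d v u)" if "u \<in> W" for u
    using word_coeff_lin_ext_generator_prod[OF p uX[OF that]] zero
    unfolding W_eq[OF that] d_def by simp
  then have "0 = (\<Sum>u\<in>W. (\<Sum>v\<in>W. Poly_Mapping.lookup p (lyndon_factors v) * d v u) * c u w)"
    by (simp add: sum.neutral)
  also have "\<dots> = (\<Sum>u\<in>W. \<Sum>v\<in>W. Poly_Mapping.lookup p (lyndon_factors v) * (d v u * c u w))"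
    by (simp add: sum_distrib_right mult.assoc)
  also have "\<dots> = (\<Sum>v\<in>W. Poly_Mapping.lookup p (lyndon_factors v) * (\<Sum>u\<in>W. d v u * c u w))"
    by (subst sum.swap) (simp add: sum_distrib_left)
  also have "\<dots> = (\<Sum>v\<in>W. if v = w then Poly_Mapping.lookup p Q else 0)"
    by (rule sum.cong) (use dc w in auto)
  also have "\<dots> = Poly_Mapping.lookup p Q" using finW w by simp
  finally show False using Q by (simp add: in_keys_iff)
qed

section \<open>Polynomial rings\<close>

definition relabel :: "('a \<Rightarrow> 'b) \<Rightarrow> ('a \<Rightarrow>\<^sub>0 int) \<Rightarrow> ('b \<Rightarrow>\<^sub>0 int)" where
  "relabel \<theta> p = (\<Sum>m\<in>Poly_Mapping.keys p. Poly_Mapping.single (\<theta> m) (Poly_Mapping.lookup p m))"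

lemma lin_ext_relabel: "lin_ext g (relabel \<theta> p) = lin_ext (\<lambda>m. g (\<theta> m)) p"
  by (simp add: relabel_def lin_ext_sum) (simp add: lin_ext_def)

lemma keys_relabel: "Poly_Mapping.keys (relabel \<theta> p) \<subseteq> \<theta> ` Poly_Mapping.keys p"
  unfolding relabel_def by (auto dest!: subsetD[OF keys_sum] split: if_splits)

lemma lookup_relabel:
  assumes "inj_on \<theta> (Poly_Mapping.keys p)" "m \<in> Poly_Mapping.keys p"
  shows "Poly_Mapping.lookup (relabel \<theta> p) (\<theta> m) = Poly_Mapping.lookup p m"
proof -
  have "Poly_Mapping.lookup (relabel \<theta> p) (\<theta> m) =
    (\<Sum>k\<in>Poly_Mapping.keys p. if k = m then Poly_Mapping.lookup p m else 0)"
    unfolding relabel_def lookup_sum lookup_single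
    by (rule sum.cong) (use assms in \<open>auto simp: when_def inj_on_def\<close>)
  then show ?thesis using assms by simp
qed

definition mset_of_monomial :: "('y \<Rightarrow> 'w) \<Rightarrow> ('y \<Rightarrow>\<^sub>0 nat) \<Rightarrow> 'w multiset" where
  "mset_of_monomial \<delta> m = (\<Sum>y\<in>Poly_Mapping.keys m. replicate_mset (Poly_Mapping.lookup m y) (\<delta> y))"

lemma mset_of_monomial_superset:
  assumes "finite F" "Poly_Mapping.keys m \<subseteq> F"
  shows "mset_of_monomial \<delta> m = (\<Sum>y\<in>F. replicate_mset (Poly_Mapping.lookup m y) (\<delta> y))"
  unfolding mset_of_monomial_def
  by (rule sum.mono_neutral_left) (use assms in \<open>auto simp: in_keys_iff\<close>)

lemma mset_of_monomial_add:
  fixes \<delta> :: "'y \<Rightarrow> 'w"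
  shows "mset_of_monomial \<delta> (m + m') = mset_of_monomial \<delta> m + mset_of_monomial \<delta> m'"
proof -
  let ?F = "Poly_Mapping.keys m \<union> Poly_Mapping.keys m'"
  have rep: "replicate_mset (a + b) w = replicate_mset a w + replicate_mset b w" for a b and w :: 'w
    by (rule multiset_eqI) simp
  have "mset_of_monomial \<delta> (m + m') = (\<Sum>y\<in>?F. replicate_mset (Poly_Mapping.lookup (m + m') y) (\<delta> y))"
    by (rule mset_of_monomial_superset) (use Poly_Mapping.keys_add[of m m'] in auto)
  also have "\<dots> = (\<Sum>y\<in>?F. replicate_mset (Poly_Mapping.lookup m y) (\<delta> y)) +
      (\<Sum>y\<in>?F. replicate_mset (Poly_Mapping.lookup m' y) (\<delta> y))"
    by (simp only: lookup_add rep sum.distrib)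
  also have "\<dots> = mset_of_monomial \<delta> m + mset_of_monomial \<delta> m'"
    by (subst (1 2) mset_of_monomial_superset[of ?F]) auto
  finally show ?thesis .
qed

lemma mset_of_monomial_zero [simp]: "mset_of_monomial \<delta> 0 = {#}"
  by (simp add: mset_of_monomial_def)

lemma count_mset_of_monomial:
  assumes "inj_on \<delta> Y" "Poly_Mapping.keys m \<subseteq> Y" "y \<in> Y"
  shows "count (mset_of_monomial \<delta> m) (\<delta> y) = Poly_Mapping.lookup m y"
proof -
  have "count (mset_of_monomial \<delta> m) (\<delta> y) =
    (\<Sum>z\<in>Poly_Mapping.keys m. if z = y then Poly_Mapping.lookup m y else 0)"
    unfolding mset_of_monomial_def count_sum
    by (rule sum.cong) (use assms in \<open>auto simp: inj_on_def\<close>)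
  then show ?thesis by (auto simp: in_keys_iff)
qed

lemma bij_betw_mset_of_monomial:
  assumes \<delta>: "bij_betw \<delta> Y L"
  shows "bij_betw (mset_of_monomial \<delta>) {m. Poly_Mapping.keys m \<subseteq> Y} {Q. set_mset Q \<subseteq> L}"
proof -
  have inj: "inj_on \<delta> Y" and im: "\<delta> ` Y = L" using \<delta> by (auto simp: bij_betw_def)
  have "inj_on (mset_of_monomial \<delta>) {m. Poly_Mapping.keys m \<subseteq> Y}"
  proof (rule inj_onI, rule poly_mapping_eqI)
    fix m m' y assume *: "m \<in> {m. Poly_Mapping.keys m \<subseteq> Y}" "m' \<in> {m. Poly_Mapping.keys m \<subseteq> Y}"
      "mset_of_monomial \<delta> m = mset_of_monomial \<delta> m'"
    show "Poly_Mapping.lookup m y = Poly_Mapping.lookup m' y"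
    proof (cases "y \<in> Y")
      case True
      then show ?thesis using * count_mset_of_monomial[OF inj] by (metis mem_Collect_eq)
    next
      case False
      then have "y \<notin> Poly_Mapping.keys m" "y \<notin> Poly_Mapping.keys m'" using * by auto
      then show ?thesis by (simp add: in_keys_iff)
    qed
  qed
  moreover have "set_mset (mset_of_monomial \<delta> m) \<subseteq> L" if "Poly_Mapping.keys m \<subseteq> Y" for m
    using that im unfolding mset_of_monomial_def by (auto simp: set_mset_sum split: if_splits)
  moreover have "\<exists>m. Poly_Mapping.keys m \<subseteq> Y \<and> mset_of_monomial \<delta> m = Q" if "set_mset Q \<subseteq> L" for Q
    using that
  proof (induction Q)
    case empty
    show ?case by (intro exI[of _ 0]) simp
  next
    case (add w Q)
    then obtain m where m: "Poly_Mapping.keys m \<subseteq> Y" "mset_of_monomial \<delta> m = Q" by auto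
    obtain y where y: "y \<in> Y" "\<delta> y = w" using add.prems im by auto
    have "mset_of_monomial \<delta> (Poly_Mapping.single y 1 + m) = add_mset w Q"
      using m y by (simp add: mset_of_monomial_add) (simp add: mset_of_monomial_def)
    moreover have "Poly_Mapping.keys (Poly_Mapping.single y 1 + m) \<subseteq> Y"
      using m y Poly_Mapping.keys_add[of "Poly_Mapping.single y 1" m] by auto
    ultimately show ?case by blast
  qed
  ultimately show ?thesis unfolding bij_betw_def by (auto simp: image_iff) metis
qed

lemma generated_is_polynomial_ring:
  fixes X :: "'b::linorder set"
  assumes \<delta>: "bij_betw \<delta> Y (lyndon_words X)"
  shows "bij_betw (lin_ext (\<lambda>m. generator_prod (mset_of_monomial \<delta> m)))
    {p. \<forall>m\<in>Poly_Mapping.keys p. Poly_Mapping.keys m \<subseteq> Y} (generated X)"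
proof -
  let ?\<theta> = "mset_of_monomial \<delta>" and ?M = "{m. Poly_Mapping.keys m \<subseteq> Y}" and ?Q = "{Q. set_mset Q \<subseteq> lyndon_words X}"
  let ?ev = "lin_ext (\<lambda>m. generator_prod (?\<theta> m))"
  have \<theta>: "bij_betw ?\<theta> ?M ?Q" by (rule bij_betw_mset_of_monomial[OF \<delta>])
  have \<theta>_in: "set_mset (?\<theta> m) \<subseteq> lyndon_words X" if "Poly_Mapping.keys m \<subseteq> Y" for m
    using bij_betwE[OF \<theta>] that by simp
  have inj: "p = q" if pq: "\<forall>m\<in>Poly_Mapping.keys p. Poly_Mapping.keys m \<subseteq> Y"
    "\<forall>m\<in>Poly_Mapping.keys q. Poly_Mapping.keys m \<subseteq> Y" "?ev p = ?ev q" for p q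
  proof -
    have k: "Poly_Mapping.keys (p - q) \<subseteq> ?M" using pq keys_diff[of p q] by blast
    have "lin_ext generator_prod (relabel ?\<theta> (p - q)) = 0"
      using pq by (simp add: lin_ext_relabel lin_ext_diff)
    moreover have "\<forall>Q\<in>Poly_Mapping.keys (relabel ?\<theta> (p - q)). set_mset Q \<subseteq> lyndon_words X"
    proof
      fix Q assume "Q \<in> Poly_Mapping.keys (relabel ?\<theta> (p - q))"
      then obtain m where "m \<in> Poly_Mapping.keys (p - q)" "Q = ?\<theta> m"
        using subsetD[OF keys_relabel] by fast
      then show "set_mset Q \<subseteq> lyndon_words X" using k \<theta>_in[of m] by auto
    qed
    ultimately have "relabel ?\<theta> (p - q) = 0" by (intro generator_prods_independent)
    moreover have "inj_on ?\<theta> (Poly_Mapping.keys (p - q))"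
      by (rule inj_on_subset[OF bij_betw_imp_inj_on[OF \<theta>] k])
    ultimately have "m \<notin> Poly_Mapping.keys (p - q)" for m
      using lookup_relabel[of ?\<theta> "p - q" m] by (auto simp: in_keys_iff)
    then have "p - q = 0" by (intro poly_mapping_eqI) (simp add: in_keys_iff)
    then show "p = q" by simp
  qed
  have sub: "?ev p \<in> generated X" if p: "\<forall>m\<in>Poly_Mapping.keys p. Poly_Mapping.keys m \<subseteq> Y" for p
  proof -
    have "generator_prod Q \<in> generated X" if "set_mset Q \<subseteq> lyndon_words X" for Q
      using that unfolding generated_def generator_prod_def
      by (induction Q) (auto intro: ring_closure.intros)
    moreover have "set_mset (?\<theta> m) \<subseteq> lyndon_words X" if "m \<in> Poly_Mapping.keys p" for m
      using p that by (intro \<theta>_in) simp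
    ultimately show ?thesis
      unfolding generated_def by (intro lin_ext_in_ring_closure) blast
  qed
  have surj: "\<exists>p. (\<forall>m\<in>Poly_Mapping.keys p. Poly_Mapping.keys m \<subseteq> Y) \<and> ?ev p = t" if t: "t \<in> generated X" for t
  proof -
    obtain q where q: "\<forall>Q\<in>Poly_Mapping.keys q. set_mset Q \<subseteq> lyndon_words X" "lin_ext generator_prod q = t"
      using generated_eq_lin_ext[OF t] by blast
    let ?\<iota> = "inv_into ?M ?\<theta>"
    have \<iota>: "?\<iota> Q \<in> ?M" "?\<theta> (?\<iota> Q) = Q" if "Q \<in> Poly_Mapping.keys q" for Q
      using q(1) that bij_betwE[OF bij_betw_inv_into[OF \<theta>]] bij_betw_inv_into_right[OF \<theta>, of Q]
      by simp_all
    have "?ev (relabel ?\<iota> q) = lin_ext generator_prod q"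
      unfolding lin_ext_relabel using \<iota> by (intro lin_ext_cong) simp
    moreover have "\<forall>m\<in>Poly_Mapping.keys (relabel ?\<iota> q). Poly_Mapping.keys m \<subseteq> Y"
      using keys_relabel[of ?\<iota> q] \<iota> by blast
    ultimately show ?thesis using q by blast
  qed
  let ?P = "{p. \<forall>m\<in>Poly_Mapping.keys p. Poly_Mapping.keys m \<subseteq> Y}"
  show ?thesis
    unfolding bij_betw_def
  proof
    show "inj_on ?ev ?P" by (rule inj_onI, rule inj) simp_all
    show "?ev ` ?P = generated X"
    proof
      show "?ev ` ?P \<subseteq> generated X" by (rule image_subsetI) (simp add: sub)
      show "generated X \<subseteq> ?ev ` ?P"
      proof
        fix t assume "t \<in> generated X"
        from surj[OF this] obtain p where "p \<in> ?P" "?ev p = t" by auto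
        then show "t \<in> ?ev ` ?P" by (intro image_eqI[of t ?ev p]) simp_all
      qed
    qed
  qed
qed

section \<open>The mixable shuffle algebra\<close>

text \<open>
  For \<open>lam = 1\<close> or \<open>lam = -1\<close> the factor \<open>lam ^ length w\<close> is a unit, so the words for weight \<open>lam\<close> and
  those for weight one have the same span.
\<close>

lemma generated_eq_realise_image:
  fixes f :: "'s::ab_semigroup_add \<Rightarrow> 'b::linorder multiset"
  assumes f: "\<And>a b. f (a + b) = f a + f b" "f ` S = free_abelian_semigroup X"
    and S: "\<And>a b. a \<in> S \<Longrightarrow> b \<in> S \<Longrightarrow> a + b \<in> S" and lam: "lam * lam = 1"
  shows "realise lam f ` {p. Poly_Mapping.keys p \<subseteq> lists S} = generated X"
proof
  show "realise lam f ` {p. Poly_Mapping.keys p \<subseteq> lists S} \<subseteq> generated X"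
  proof clarify
    fix p :: "'s list \<Rightarrow>\<^sub>0 int" assume p: "Poly_Mapping.keys p \<subseteq> lists S"
    have "qsym lam f w \<in> generated X" if "w \<in> Poly_Mapping.keys p" for w
    proof -
      have "map f w \<in> words X" using p that f(2) by (auto simp: in_lists_conv_set)
      then have "qsym 1 id (map f w) \<in> generated X" by (rule word_in_generated)
      moreover have "qsym lam f w = of_int (lam ^ length w) * qsym 1 id (map f w)"
        by (auto simp: qsym_def fun_eq_iff of_int_fun_apply simp del: of_int_power)
      ultimately show ?thesis
        unfolding generated_def by (metis ring_closure.mult ring_closure_of_int)
    qed
    then show "realise lam f p \<in> generated X"
      unfolding realise_def generated_def by (intro lin_ext_in_ring_closure)
  qed
next
  let ?A = "realise lam f ` {p. Poly_Mapping.keys p \<subseteq> lists S}"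
  have word: "qsym 1 id w \<in> ?A" if "w \<in> words X" for w
  proof -
    have "w \<in> map f ` lists S" using that by (simp only: lists_image[symmetric] f(2))
    then obtain v where v: "v \<in> lists S" "map f v = w" by blast
    have "(lam ^ length v) * (lam ^ length v) = 1" using lam by (simp flip: power_mult_distrib)
    then have "of_int (lam ^ length v) * (of_int (lam ^ length v) * x) = x" for x :: "(nat \<Rightarrow>\<^sub>0 'b multiset) \<Rightarrow>\<^sub>0 int"
      by (metis mult.assoc mult_1 of_int_1 of_int_mult)
    then have "realise lam f (Poly_Mapping.single v (lam ^ length v)) = qsym 1 id w"
      using v by (simp add: realise_def qsym_def fun_eq_iff of_int_fun_apply del: of_int_power)
    moreover have "Poly_Mapping.keys (Poly_Mapping.single v (lam ^ length v)) \<subseteq> lists S" using v by simp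
    ultimately show ?thesis by (metis (mono_tags, lifting) image_eqI mem_Collect_eq)
  qed
  have one: "1 \<in> ?A"
    by (rule image_eqI[of _ _ "Poly_Mapping.single [] 1"]) simp_all
  have diff: "s - t \<in> ?A" if "s \<in> ?A" "t \<in> ?A" for s t
  proof -
    from that obtain p q where "s = realise lam f p" "t = realise lam f q"
      "Poly_Mapping.keys p \<subseteq> lists S" "Poly_Mapping.keys q \<subseteq> lists S" by blast
    then show ?thesis
      using keys_diff[of p q] by (intro image_eqI[of _ _ "p - q"]) (auto simp: realise_def lin_ext_diff)
  qed
  have mult: "s * t \<in> ?A" if "s \<in> ?A" "t \<in> ?A" for s t
  proof -
    from that obtain p q where pq: "s = realise lam f p" "t = realise lam f q"
      "Poly_Mapping.keys p \<subseteq> lists S" "Poly_Mapping.keys q \<subseteq> lists S" by blast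
    have "Poly_Mapping.keys (mixable_shuffle lam p q) \<subseteq> lists S"
      using keys_mixable_shuffle[of lam p q] keys_word_mixable_shuffle_lists[of S _ _ lam, OF S] pq
      by blast
    then show ?thesis
      using pq by (intro image_eqI[of _ _ "mixable_shuffle lam p q"]) (simp_all add: realise_mixable_shuffle[OF f(1)])
  qed
  have closed: "ring_closure ?A \<subseteq> ?A"
  proof
    fix t assume "t \<in> ring_closure ?A"
    then show "t \<in> ?A" by (induction rule: ring_closure.induct) (simp_all only: one diff mult)
  qed
  have "realise 1 id (generator w) \<in> ?A" if "w \<in> lyndon_words X" for w
  proof -
    have "qsym 1 id u \<in> ?A" if "u \<in> Poly_Mapping.keys (generator w)" for u
      by (rule word) (use keys_generator[OF \<open>w \<in> lyndon_words X\<close>] that in blast)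
    then have "lin_ext (qsym 1 id) (generator w) \<in> ring_closure ?A"
      by (intro lin_ext_in_ring_closure ring_closure.gen)
    then show ?thesis using closed unfolding realise_def[of 1 id] by (rule subsetD[rotated])
  qed
  then have "generated X \<subseteq> ring_closure ?A"
    unfolding generated_def by (intro ring_closure_subset) (blast intro: ring_closure.gen)
  then show "generated X \<subseteq> ?A" using closed by blast
qed

theorem theorem5p4:
  fixes X :: "'x set" and lam :: int
  assumes "countable X"
    and "lam = 1 \<or> lam = -1"
  shows "is_polynomial_algebra (mixable_shuffle_algebra lam (free_abelian_semigroup X))"
proof -
  let ?S = "free_abelian_semigroup X"
  let ?A = "mixable_shuffle_algebra lam ?S"
  define C where "C = {p :: 'x multiset list \<Rightarrow>\<^sub>0 int. Poly_Mapping.keys p \<subseteq> lists ?S}"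
  define e where "e = to_nat_on X"
  have e: "inj_on e X" unfolding e_def using assms(1) by (rule inj_on_to_nat_on)
  let ?f = "image_mset e"
  have f_inj: "inj_on ?f ?S"
  proof (rule inj_on_inverseI[of _ "image_mset (inv_into X e)"])
    fix a assume "a \<in> ?S"
    then have "image_mset (\<lambda>x. inv_into X e (e x)) a = image_mset id a"
      using e by (intro image_mset_cong) (auto simp: free_abelian_semigroup_def)
    then show "image_mset (inv_into X e) (image_mset e a) = a" by (simp add: image_mset.compositionality o_def)
  qed
  have f_im: "?f ` ?S = free_abelian_semigroup (e ` X)"
  proof
    show "?f ` ?S \<subseteq> free_abelian_semigroup (e ` X)"
      by (auto simp: free_abelian_semigroup_def intro!: imageI)
    show "free_abelian_semigroup (e ` X) \<subseteq> ?f ` ?S"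
    proof
      fix b assume b: "b \<in> free_abelian_semigroup (e ` X)"
      then have "image_mset (\<lambda>x. e (inv_into X e x)) b = image_mset id b"
        by (intro image_mset_cong) (auto simp: free_abelian_semigroup_def f_inv_into_f)
      then have "b = ?f (image_mset (inv_into X e) b)" by (simp add: image_mset.compositionality o_def)
      moreover have "image_mset (inv_into X e) b \<in> ?S"
        using b by (auto simp: free_abelian_semigroup_def inv_into_into subset_iff)
      ultimately show "b \<in> ?f ` ?S" by blast
    qed
  qed
  define \<Phi> where "\<Phi> = realise lam ?f"
  have \<Phi>: "bij_betw \<Phi> C (generated (e ` X))"
    unfolding bij_betw_def
  proof
    show "inj_on \<Phi> C"
    proof (rule inj_onI)
      fix p q assume "p \<in> C" "q \<in> C" "\<Phi> p = \<Phi> q"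
      then show "p = q"
        using assms(2) unfolding \<Phi>_def C_def
        by (intro realise_inj[OF f_inj, of lam p q]) (auto simp: free_abelian_semigroup_def)
    qed
    show "\<Phi> ` C = generated (e ` X)"
      unfolding \<Phi>_def C_def
      by (rule generated_eq_realise_image) (use f_im assms(2) free_abelian_semigroup_add in auto)
  qed
  have C_mult: "mixable_shuffle lam p q \<in> C" if "p \<in> C" "q \<in> C" for p q
    using that keys_mixable_shuffle[of lam p q] keys_word_mixable_shuffle_words[of _ X _ lam]
    unfolding C_def by blast
  have C_add: "p + q \<in> C" if "p \<in> C" "q \<in> C" for p q
    using that Poly_Mapping.keys_add[of p q] unfolding C_def by blast
  have C_scale: "scale c p \<in> C" if "p \<in> C" for c p
    using that keys_scale[of c p] unfolding C_def by blast
  have C_one: "Poly_Mapping.single [] 1 \<in> C" unfolding C_def by simp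
  \<comment> \<open>The variables have to be elements of the algebra; any injective labelling of the Lyndon words will do.\<close>
  define lab where "lab w = Poly_Mapping.single (map (inv_into ?S ?f) w) (1 :: int)" for w
  define Y where "Y = lab ` lyndon_words (e ` X)"
  have "inj_on lab (lyndon_words (e ` X))"
  proof (rule inj_onI)
    fix v w assume *: "v \<in> lyndon_words (e ` X)" "w \<in> lyndon_words (e ` X)" "lab v = lab w"
    have "map ?f (map (inv_into ?S ?f) u) = u" if "u \<in> lyndon_words (e ` X)" for u
      using that f_im by (intro map_idI[of u "?f \<circ> inv_into ?S ?f", folded map_map]) (auto simp: lyndon_words_def in_lists_conv_set f_inv_into_f)
    moreover have "map (inv_into ?S ?f) v = map (inv_into ?S ?f) w"
      using arg_cong[OF *(3), of Poly_Mapping.keys] by (simp add: lab_def)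
    ultimately show "v = w" using * by metis
  qed
  then have "bij_betw lab (lyndon_words (e ` X)) Y" by (simp add: bij_betw_def Y_def)
  then obtain \<delta> where \<delta>: "bij_betw \<delta> Y (lyndon_words (e ` X))" using bij_betw_inv_into by blast
  define P where "P = {p :: (('x multiset list \<Rightarrow>\<^sub>0 int) \<Rightarrow>\<^sub>0 nat) \<Rightarrow>\<^sub>0 int. \<forall>m\<in>Poly_Mapping.keys p. Poly_Mapping.keys m \<subseteq> Y}"
  define ev where "ev = lin_ext (\<lambda>m. generator_prod (mset_of_monomial \<delta> m))"
  have ev: "bij_betw ev P (generated (e ` X))"
    unfolding ev_def P_def by (rule generated_is_polynomial_ring[OF \<delta>])
  have P_mult: "p * q \<in> P" if "p \<in> P" "q \<in> P" for p q
  proof -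
    have "Poly_Mapping.keys m \<subseteq> Y" if m: "m \<in> Poly_Mapping.keys (p * q)" for m
    proof -
      obtain a b where "m = a + b" "a \<in> Poly_Mapping.keys p" "b \<in> Poly_Mapping.keys q"
        using m keys_mult[of p q] by blast
      then show ?thesis using \<open>p \<in> P\<close> \<open>q \<in> P\<close> Poly_Mapping.keys_add[of a b] unfolding P_def by blast
    qed
    then show ?thesis unfolding P_def by blast
  qed
  have P_add: "p + q \<in> P" if "p \<in> P" "q \<in> P" for p q
    using that Poly_Mapping.keys_add[of p q] unfolding P_def by blast
  have P_scale: "scale c p \<in> P" if "p \<in> P" for c p
    using that keys_scale[of c p] unfolding P_def by blast
  have P_one: "1 \<in> P" unfolding P_def by simp
  \<comment> \<open>Both \<open>ev\<close> and \<open>\<Phi>\<close> are injective ring homomorphisms onto the same subring.\<close>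
  define h where "h p = the_inv_into C \<Phi> (ev p)" for p
  have h: "bij_betw h P C"
    unfolding h_def using bij_betw_trans[OF ev bij_betw_the_inv_into[OF \<Phi>]] by (simp add: o_def)
  then have hC: "h p \<in> C" if "p \<in> P" for p using that unfolding bij_betw_def by blast
  have \<Phi>h: "\<Phi> (h p) = ev p" if "p \<in> P" for p
    unfolding h_def using f_the_inv_into_f_bij_betw[OF \<Phi>] bij_betwE[OF ev] that by blast
  have h_eq: "h p = q" if "p \<in> P" "q \<in> C" "ev p = \<Phi> q" for p q
    using \<Phi> hC[OF that(1)] \<Phi>h[OF that(1)] that unfolding bij_betw_def inj_on_def by metis
  have ev_mult: "ev (p * q) = ev p * ev q" for p q
    unfolding ev_def by (rule lin_ext_mult) (simp add: mset_of_monomial_add generator_prod_union)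
  have \<Phi>_mult: "\<Phi> (mixable_shuffle lam p q) = \<Phi> p * \<Phi> q" for p q
    unfolding \<Phi>_def by (rule realise_mixable_shuffle) simp
  have "h (p * q) = mixable_shuffle lam (h p) (h q)" if "p \<in> P" "q \<in> P" for p q
    by (rule h_eq) (use that P_mult C_mult hC in \<open>simp_all add: ev_mult \<Phi>_mult \<Phi>h\<close>)
  moreover have "h (p + q) = h p + h q" if "p \<in> P" "q \<in> P" for p q
    by (rule h_eq) (use that P_add C_add hC \<Phi>h in \<open>simp_all add: ev_def \<Phi>_def realise_def lin_ext_add\<close>)
  moreover have h_scale: "h (scale c p) = scale c (h p)" if "p \<in> P" for c p
    by (rule h_eq) (use that P_scale C_scale hC \<Phi>h in \<open>simp_all add: ev_def \<Phi>_def realise_def lin_ext_scale\<close>)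
  moreover have "h 1 = Poly_Mapping.single [] 1"
  proof (rule h_eq[OF P_one C_one])
    have "ev (Poly_Mapping.single 0 1) = 1" unfolding ev_def lin_ext_single by simp
    then show "ev 1 = \<Phi> (Poly_Mapping.single [] 1)" by (simp add: \<Phi>_def)
  qed
  ultimately have "h \<in> ring_iso (polynomial_algebra Y) ?A"
    using h hC by (auto simp: ring_iso_def Ring.ring_hom_def polynomial_algebra_def mixable_shuffle_algebra_def P_def C_def)
  moreover have "\<forall>(c :: int). \<forall>p\<in>carrier (polynomial_algebra Y). h (c \<odot>\<^bsub>polynomial_algebra Y\<^esub> p) = c \<odot>\<^bsub>?A\<^esub> h p"
    using h_scale by (simp add: polynomial_algebra_def mixable_shuffle_algebra_def P_def)
  ultimately show ?thesis unfolding is_polynomial_algebra_def by blast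
qed

end
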